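(* For any $\mathscr{B}\subset\mathbb{N}$, there exists a unique taut set $\mathscr{B}'\subset\mathbb{N}$ such that $\mathcal{F}_{\mathscr{B}'}\subset\mathcal{F}_{\mathscr{B}}$ and any point $x\in\widetilde{X}_\eta$ is attracted to $\widetilde{X}_{\eta'}$ along a sequence of integers of density $1$: there is a set $E_x$ of density $0$ such that $$\lim_{n\to\infty,\ n\notin E_x}\operatorname{dist}(S^nx,\widetilde{X}_{\eta'})=0 .$$
   Context: $\mathbb{N}=\{1,2,\dots\}$. For $\mathscr{B}\subset\mathbb{N}$ let $\mathcal{M}_{\mathscr{B}}:=\bigcup_{b\in\mathscr{B}}b\mathbb{Z}$, $\mathcal{F}_{\mathscr{B}}:=\mathbb{Z}\setminus\mathcal{M}_{\mathscr{B}}$, and let $\eta\in\{0,1\}^{\mathbb{Z}}$ be the characteristic function of $\mathcal{F}_{\mathscr{B}}$; similarly $\eta'$ is the characteristic function of $\mathcal{F}_{\mathscr{B}'}$. $S$ is the left shift on $\{0,1\}^{\mathbb{Z}}$ (product topology, with a compatible metric; $\operatorname{dist}$ is the distance from a point to a set), and $X_\eta$ is the closure of $\{S^m\eta : m\in\mathbb{Z}\}$. A subshift $X\subset\{0,1\}^{\mathbb{Z}}$ (closed, $S$-invariant set) is hereditary if $x\in X$ and $y\le x$ coordinatewise imply $y\in X$. $\widetilde{X}_\eta$ is the smallest hereditary subshift containing $X_\eta$ (and $\widetilde{X}_{\eta'}$ is defined likewise from $\eta'$). The density of $E\subset\mathbb{Z}$ is $d(E)=\lim_{N\to\infty}\frac1N|E\cap[1,N]|$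 if it exists. The logarithmic density of $A\subset\mathbb{Z}$ is $\boldsymbol{\delta}(A)=\lim_{N\to\infty}\frac{1}{\log N}\sum_{a\in A,1\le a\le N}\frac1a$ when the limit exists; it always exists for $A=\mathcal{M}_{\mathscr{B}}$ (Davenport–Erdős). $\mathscr{B}$ is taut if $\boldsymbol{\delta}(\mathcal{M}_{\mathscr{B}\setminus\{b\}})<\boldsymbol{\delta}(\mathcal{M}_{\mathscr{B}})$ for each $b\in\mathscr{B}$. *)

theory Defs
  imports "HOL-Analysis.Analysis"
begin

text \<open>
  The space of two-sided 0-1 sequences is rendered as \<^typ>\<open>int \<Rightarrow> bool\<close>, with 1 encoded as
  \<^const>\<open>True\<close>. The library topology on this type is the product of the discrete topologies,
  and the library order \<open>\<le>\<close> on it is the coordinatewise order with 0 below 1.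
  The set of positive integers is \<open>{1..} :: nat set\<close>.
\<close>

definition multiples_of :: "nat set \<Rightarrow> int set" where
  "multiples_of B = (\<Union>b\<in>B. {int b * k | k. True})"

definition free_of :: "nat set \<Rightarrow> int set" where
  "free_of B = UNIV - multiples_of B"

definition eta :: "nat set \<Rightarrow> int \<Rightarrow> bool" where
  "eta B = (\<lambda>n. n \<in> free_of B)"

definition left_shift :: "(int \<Rightarrow> bool) \<Rightarrow> int \<Rightarrow> bool" where
  "left_shift x = (\<lambda>k. x (k + 1))"

text \<open>
  The \<open>m\<close>-th power of the left shift for an arbitrary integer \<open>m\<close>; the lemmas below show that
  it is the integer power of the bijection \<^const>\<open>left_shift\<close>.
\<close>

definition shift_pow :: "int \<Rightarrow> (int \<Rightarrow> bool) \<Rightarrow> int \<Rightarrow> bool" where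
  "shift_pow m x = (\<lambda>k. x (k + m))"

lemma shift_pow_of_nat: "shift_pow (int n) = left_shift ^^ n"
proof (induction n)
  case 0
  then show ?case by (simp add: shift_pow_def fun_eq_iff)
next
  case (Suc n)
  have "shift_pow (int (Suc n)) = left_shift \<circ> shift_pow (int n)"
    by (simp add: shift_pow_def left_shift_def fun_eq_iff add.assoc)
  with Suc show ?case by simp
qed

lemma shift_pow_uminus:
  "shift_pow (- m) \<circ> shift_pow m = id" "shift_pow m \<circ> shift_pow (- m) = id"
  by (simp_all add: shift_pow_def fun_eq_iff)

definition subshift :: "(int \<Rightarrow> bool) set \<Rightarrow> bool" where
  "subshift X \<longleftrightarrow> closed X \<and> left_shift ` X = X"

definition hereditary :: "(int \<Rightarrow> bool) set \<Rightarrow> bool" where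
  "hereditary X \<longleftrightarrow> (\<forall>x\<in>X. \<forall>y. y \<le> x \<longrightarrow> y \<in> X)"

definition orbit_closure :: "(int \<Rightarrow> bool) \<Rightarrow> (int \<Rightarrow> bool) set" where
  "orbit_closure x = closure {shift_pow m x | m. True}"

text \<open>
  The intersection below is itself a hereditary subshift (the shift is a bijection), hence it
  is the smallest one containing the orbit closure.
\<close>

definition hereditary_closure :: "(int \<Rightarrow> bool) \<Rightarrow> (int \<Rightarrow> bool) set" where
  "hereditary_closure x = \<Inter> {X. subshift X \<and> hereditary X \<and> orbit_closure x \<subseteq> X}"

definition has_density :: "int set \<Rightarrow> real \<Rightarrow> bool" where
  "has_density E c \<longleftrightarrow> (\<lambda>N::nat. real (card (E \<inter> {1..int N})) / real N) \<longlonglongrightarrow> c"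

text \<open>
  The value of \<^const>\<open>lim\<close> is meaningful only where the limit exists; for sets of multiples it
  always does, by the Davenport--Erdos theorem.
\<close>

definition log_density :: "int set \<Rightarrow> real" where
  "log_density A = lim (\<lambda>N::nat. (\<Sum>a\<in>A \<inter> {1..int N}. 1 / real_of_int a) / ln (real N))"

definition taut :: "nat set \<Rightarrow> bool" where
  "taut B \<longleftrightarrow> (\<forall>b\<in>B. log_density (multiples_of (B - {b})) < log_density (multiples_of B))"

text \<open>A metric on the sequence space that induces the product topology.\<close>

definition compatible_metric :: "((int \<Rightarrow> bool) \<Rightarrow> (int \<Rightarrow> bool) \<Rightarrow> real) \<Rightarrow> bool" where
  "compatible_metric d \<longleftrightarrow> Metric_space UNIV d \<and> Metric_space.mtopology UNIV d = euclidean"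

text \<open>The infimum is only used for nonempty \<open>A\<close>.\<close>

definition dist_to_set ::
  "((int \<Rightarrow> bool) \<Rightarrow> (int \<Rightarrow> bool) \<Rightarrow> real) \<Rightarrow> (int \<Rightarrow> bool) \<Rightarrow> (int \<Rightarrow> bool) set \<Rightarrow> real" where
  "dist_to_set d x A = (INF a\<in>A. d x a)"

end

theory Submission
  imports Defs "HOL-Real_Asymp.Real_Asymp"
begin

text \<open>
  Write \<open>\<delta>(A)\<close> for the logarithmic density of the set of multiples of \<open>A\<close>. The proof rests on the
  equivalence, for \<open>B\<close> and a set \<open>C\<close> with \<open>B \<subseteq> multiples C\<close>, between attraction of the hereditary
  closure of \<open>eta B\<close> to that of \<open>eta C\<close> along density one, and the equality \<open>\<delta>(C) = \<delta>(B)\<close>. This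
  reduces the theorem to the existence and uniqueness of a taut set with the same density and at
  least the same multiples.

  Everything depends on the theorem of Davenport and Erdos (\<open>davenport_erdos\<close>): the logarithmic
  density exists, and it is the supremum \<open>mult_dens A\<close> of the natural densities of the sets of
  multiples of finite subsets. It follows from a comparison of natural density with the probability
  measure that gives \<open>n\<close> a weight proportional to \<open>n\<close> to the power \<open>-s\<close>, for \<open>s > 1\<close>. Under
  both, divisibility by distinct primes is independent, and for sets that depend on finitely many
  primes one can split off one prime at a time (\<open>mean_split_prime\<close>). In this way one sees that
  the complement of the multiples of a finite set is at least as likely under the weighted measure
  as under natural density (\<open>dens_le_zeta_mean\<close>), and that the difference disappears as \<open>s\<close> tends
  to 1. Putting
  \<open>s = 1 + 1 / ln N\<close> bounds logarithmic sums up to \<open>N\<close>. The same induction over primes yields the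
  positive correlation of divisor-closed sets and thereby Behrend's inequality
  \<open>(1 - \<delta>(X)) (1 - \<delta>(Y)) \<le> 1 - \<delta>(X \<union> Y)\<close>.

  For the algebra of taut sets, let the saturation of \<open>B\<close> be the set of all \<open>c\<close> with
  \<open>\<delta>(B \<union> {c}) = \<delta>(B)\<close>. It has the same density as \<open>B\<close>. Behrend's inequality shows that such a
  redundancy has a single cause: some divisor \<open>g\<close> of \<open>c\<close> and elements of \<open>B\<close> of the form \<open>g a\<close>,
  where the multiples of the \<open>a\<close> have density 1 (\<open>scaled_Behrend_part\<close>). Consequently the minimal
  elements of the saturation form a taut set, and it is the only taut set with the same density as
  \<open>B\<close> whose multiples include those of \<open>B\<close> (\<open>taut_primitive_core_saturation\<close>, \<open>taut_unique\<close>).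

  For the dynamics, a point \<open>x\<close> of the hereditary closure of \<open>eta B\<close> vanishes on a translate of the
  multiples of any finite \<open>F \<subseteq> B\<close>. If \<open>F\<close> nearly exhausts the density, then the windows in which
  the pattern of numbers free of \<open>F\<close> is not below a window of \<open>eta C\<close> form a periodic set of small
  logarithmic, hence of small natural density; this gives attraction
  (\<open>undominated_windows_density_zero\<close>). Conversely, points near the hereditary closure of \<open>eta C\<close>
  cannot have too many ones in a window, and applied to \<open>eta B\<close> itself this gives
  \<open>\<delta>(C) \<le> \<delta>(B)\<close> (\<open>mult_dens_le_of_attraction\<close>).
\<close>

section \<open>Natural density of periodic sets\<close>

definition count_upto :: "nat set \<Rightarrow> nat \<Rightarrow> nat" where
  "count_upto X N = card (X \<inter> {1..N})"

definition dens :: "nat set \<Rightarrow> real" where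
  "dens X = lim (\<lambda>N. real (count_upto X N) / real N)"

definition periodic :: "nat \<Rightarrow> nat set \<Rightarrow> bool" where
  "periodic Q X \<longleftrightarrow> 0 < Q \<and> (\<forall>n. n + Q \<in> X \<longleftrightarrow> n \<in> X)"

lemma count_upto_0 [simp]: "count_upto X 0 = 0"
  by (simp add: count_upto_def)

lemma count_upto_Suc: "count_upto X (Suc N) = count_upto X N + (if Suc N \<in> X then 1 else 0)"
proof -
  have "X \<inter> {1..Suc N} = (if Suc N \<in> X then insert (Suc N) (X \<inter> {1..N}) else X \<inter> {1..N})"
    by (auto simp: le_Suc_eq)
  thus ?thesis by (simp add: count_upto_def)
qed

lemma count_upto_le: "count_upto X N \<le> N"
  by (induction N) (auto simp: count_upto_Suc)

lemma count_upto_mono: "X \<subseteq> Y \<Longrightarrow> count_upto X N \<le> count_upto Y N"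
  unfolding count_upto_def by (intro card_mono) auto

lemma count_upto_disjoint:
  "X \<inter> Y = {} \<Longrightarrow> count_upto (X \<union> Y) N = count_upto X N + count_upto Y N"
  by (induction N) (auto simp: count_upto_Suc)

lemma count_upto_add_period:
  assumes "periodic Q X"
  shows "count_upto X (N + Q) = count_upto X N + count_upto X Q"
proof (induction N)
  case (Suc N)
  have "Suc N + Q \<in> X \<longleftrightarrow> Suc N \<in> X" using assms unfolding periodic_def by blast
  thus ?case using Suc by (simp add: count_upto_Suc)
qed simp

text \<open>
  The function \<open>N \<mapsto> |X \<inter> {1..N}| - c N\<close>, with \<open>c\<close> the proportion of \<open>X\<close> in one period, is
  itself periodic, so it is bounded by its values on the first period. A deviation that stays
  bounded, rather than being only \<open>o(N)\<close>, is what later passes to logarithmic sums.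
\<close>

lemma count_upto_periodic:
  assumes "periodic Q X"
  shows "\<bar>real (count_upto X N) - real (count_upto X Q) / real Q * real N\<bar> \<le> real Q"
proof (induction N rule: less_induct)
  case (less N)
  have Q: "0 < Q" using assms by (simp add: periodic_def)
  define c where "c = real (count_upto X Q) / real Q"
  have c: "0 \<le> c" "c \<le> 1" "c * real Q = real (count_upto X Q)"
    using Q count_upto_le[of X Q] by (auto simp: c_def divide_simps)
  show ?case
  proof (cases "N < Q")
    case True
    have "c * real N \<le> 1 * real N" using c by (intro mult_right_mono) auto
    moreover have "0 \<le> c * real N" using c by simp
    ultimately have "0 \<le> c * real N" "c * real N \<le> real N" by simp_all
    thus ?thesis using True count_upto_le[of X N] unfolding c_def[symmetric] by simp
  next
    case False
    then obtain M where M: "N = M + Q" by (metis add.commute le_Suc_ex not_less)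
    have "\<bar>real (count_upto X M) - c * real M\<bar> \<le> real Q"
      using less[of M] M Q unfolding c_def by simp
    moreover have "real (count_upto X N) - c * real N = real (count_upto X M) - c * real M"
      using c by (simp add: M count_upto_add_period[OF assms] algebra_simps)
    ultimately show ?thesis unfolding c_def[symmetric] by simp
  qed
qed

lemma tendsto_of_bounded_deviation:
  assumes "\<And>N. \<bar>f N - c * real N\<bar> \<le> C"
  shows "(\<lambda>N. f N / real N) \<longlonglongrightarrow> c"
proof -
  have "(\<lambda>N. f N / real N - c) \<longlonglongrightarrow> 0"
  proof (rule Lim_null_comparison)
    show "eventually (\<lambda>N. norm (f N / real N - c) \<le> C / real N) sequentially"
      using eventually_gt_at_top[of 0]
    proof eventually_elim
      case (elim N)
      have "f N / real N - c = (f N - c * real N) / real N" using elim by (simp add: field_simps)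
      thus ?case using assms[of N] elim by (simp add: divide_right_mono)
    qed
  qed real_asymp
  thus ?thesis by (simp add: LIM_zero_iff)
qed

lemma dens_eqI: "(\<lambda>N. real (count_upto X N) / real N) \<longlonglongrightarrow> c \<Longrightarrow> dens X = c"
  unfolding dens_def by (rule limI)

lemma dens_periodic:
  assumes "periodic Q X"
  shows "dens X = real (count_upto X Q) / real Q"
  using dens_eqI[OF tendsto_of_bounded_deviation[OF count_upto_periodic[OF assms]]] .

lemma count_upto_dens:
  assumes "periodic Q X"
  shows "\<bar>real (count_upto X N) - dens X * real N\<bar> \<le> real Q"
  using count_upto_periodic[OF assms] dens_periodic[OF assms] by simp

lemma dens_tendsto:
  assumes "periodic Q X"
  shows "(\<lambda>N. real (count_upto X N) / real N) \<longlonglongrightarrow> dens X"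
  using tendsto_of_bounded_deviation[OF count_upto_dens[OF assms]] .

lemma dens_bounds:
  assumes "periodic Q X"
  shows "0 \<le> dens X" "dens X \<le> 1"
  using count_upto_le[of X Q] assms by (auto simp: dens_periodic[OF assms] periodic_def)

lemma dens_mono:
  assumes "periodic Q X" "periodic R Y" "X \<subseteq> Y"
  shows "dens X \<le> dens Y"
  by (rule LIMSEQ_le[OF dens_tendsto[OF assms(1)] dens_tendsto[OF assms(2)]])
     (auto intro!: exI[of _ 0] divide_right_mono count_upto_mono assms)

lemma dens_disjoint:
  assumes "periodic Q X" "periodic R Y" "X \<inter> Y = {}"
  shows "dens (X \<union> Y) = dens X + dens Y"
  using tendsto_add[OF dens_tendsto[OF assms(1)] dens_tendsto[OF assms(2)]]
  by (intro dens_eqI) (simp add: count_upto_disjoint[OF assms(3)] add_divide_distrib)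

lemma dens_UNIV [simp]: "dens UNIV = 1" and dens_empty [simp]: "dens {} = 0"
  using dens_periodic[of 1 UNIV] dens_periodic[of 1 "{}"]
  by (simp_all add: periodic_def count_upto_def)

lemma dens_Compl: "periodic Q X \<Longrightarrow> dens (- X) = 1 - dens X"
  using dens_disjoint[of Q X Q "- X"] by (simp add: periodic_def)

lemma count_upto_dilate:
  assumes "0 < g"
  shows "count_upto {n \<in> X. g dvd n} N = count_upto {n. g * n \<in> X} (N div g)"
proof -
  have "{n \<in> X. g dvd n} \<inter> {1..N} = (*) g ` ({n. g * n \<in> X} \<inter> {1..N div g})"
    using assms by (auto simp: image_iff less_eq_div_iff_mult_less_eq mult.commute
        Suc_le_eq elim!: dvdE intro!: Nat.gr0I)
  moreover have "inj_on ((*) g) S" for S using assms by (auto simp: inj_on_def)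
  ultimately show ?thesis by (simp add: count_upto_def card_image)
qed

text \<open>
  On the multiples of \<open>g\<close>, the set \<open>X\<close> is \<open>{n. g n \<in> X}\<close> stretched by the factor \<open>g\<close>. For
  prime \<open>g\<close> this is the only property of the density, apart from additivity and normalisation, on
  which the decomposition by primes rests.
\<close>

lemma dens_dilate:
  assumes "0 < g" "periodic Q {n. g * n \<in> X}"
  shows "dens {n \<in> X. g dvd n} = dens {n. g * n \<in> X} / real g"
proof (rule dens_eqI, rule tendsto_of_bounded_deviation)
  fix N
  let ?Y = "{n. g * n \<in> X}"
  have g: "real g * real (N div g) \<le> real N" "real N \<le> real g * real (N div g) + real g"
    using assms(1) by (metis div_times_less_eq_dividend mult.commute of_nat_le_iff of_nat_mult,
      metis add.commute add_le_cancel_right dual_order.strict_implies_order mod_less_divisor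
        mult_div_mod_eq nat_add_left_cancel_le of_nat_add of_nat_le_iff of_nat_mult)
  have d: "0 \<le> dens ?Y" "dens ?Y \<le> 1" using dens_bounds[OF assms(2)] by auto
  have "\<bar>real (N div g) - real N / real g\<bar> \<le> 1"
    using g assms(1) by (simp add: field_simps abs_le_iff)
  hence "dens ?Y * \<bar>real (N div g) - real N / real g\<bar> \<le> 1 * 1" using d by (intro mult_mono) auto
  moreover have "dens ?Y * \<bar>real (N div g) - real N / real g\<bar>
      = \<bar>dens ?Y * (real (N div g) - real N / real g)\<bar>" using d by (simp add: abs_mult)
  ultimately have "\<bar>dens ?Y * real (N div g) - dens ?Y / real g * real N\<bar> \<le> 1"
    by (simp add: right_diff_distrib)
  with count_upto_dens[OF assms(2), of "N div g"]
  show "\<bar>real (count_upto {n \<in> X. g dvd n} N) - dens ?Y / real g * real N\<bar> \<le> real Q + 1"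
    unfolding count_upto_dilate[OF assms(1)] by linarith
qed

section \<open>Splitting off a prime\<close>

text \<open>
  Membership in a set of multiples of divisors of \<open>Q\<close> depends on \<open>gcd n Q\<close> only. Such sets carry
  an induction: for a prime \<open>p\<close> dividing \<open>Q\<close>, a set \<open>X\<close> is described by its trace on the numbers
  prime to \<open>p\<close>, which depends on the \<open>p\<close>-free part of \<open>Q\<close>, and by \<open>{n. p n \<in> X}\<close>, which depends
  on \<open>Q / p\<close>.
\<close>

definition gcd_determined :: "nat \<Rightarrow> nat set \<Rightarrow> bool" where
  "gcd_determined Q X \<longleftrightarrow> 0 < Q \<and> (\<forall>n. n \<in> X \<longleftrightarrow> gcd n Q \<in> X)"

definition divisor_closed :: "nat set \<Rightarrow> bool" where
  "divisor_closed X \<longleftrightarrow> (\<forall>n\<in>X. \<forall>m. m dvd n \<longrightarrow> m \<in> X)"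

lemma gcd_determined_periodic: "gcd_determined Q X \<Longrightarrow> periodic Q X"
  unfolding gcd_determined_def periodic_def by (metis gcd_add1)

lemma gcd_determined_multiples:
  "gcd_determined Q X \<Longrightarrow> p dvd Q \<Longrightarrow> gcd_determined Q {n \<in> X. p dvd n}"
  by (auto simp: gcd_determined_def)

lemma gcd_determined_dilate:
  assumes "gcd_determined Q X" "p dvd Q"
  shows "gcd_determined (Q div p) {n. p * n \<in> X}"
proof -
  have "gcd (p * n) Q = p * gcd n (Q div p)" for n
    using assms(2) by (metis dvd_mult_div_cancel gcd_mult_distrib_nat)
  thus ?thesis using assms unfolding gcd_determined_def
    by (metis dvd_div_eq_0_iff mem_Collect_eq neq0_conv)
qed

definition prime_free_part :: "nat \<Rightarrow> nat \<Rightarrow> nat" where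
  "prime_free_part p Q = Q div p ^ multiplicity p Q"

text \<open>
  The set that agrees with \<open>X\<close> on the numbers prime to \<open>p\<close> and does not see powers of \<open>p\<close>.
\<close>

definition ignore_prime :: "nat \<Rightarrow> nat \<Rightarrow> nat set \<Rightarrow> nat set" where
  "ignore_prime p Q X = {n. gcd n (prime_free_part p Q) \<in> X}"

lemma prime_free_part:
  assumes "prime p" "p dvd Q" "0 < Q"
  shows "prime_free_part p Q < Q" "0 < prime_free_part p Q" "\<not> p dvd prime_free_part p Q"
    "\<exists>v. Q = p ^ v * prime_free_part p Q"
proof -
  have "\<not> is_unit p" using assms(1) by auto
  then obtain y where y: "Q = y * p ^ multiplicity p Q" "\<not> p dvd y"
    using multiplicity_decompose'[of Q p] assms by (metis mult.commute neq0_conv)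
  have p: "0 < p" using assms(1) prime_gt_0_nat by blast
  have eq: "prime_free_part p Q = y" unfolding prime_free_part_def
    using y(1) p by (metis nonzero_mult_div_cancel_right not_gr_zero power_eq_0_iff)
  show "0 < prime_free_part p Q" using y(1) assms(3) eq by (metis mult_0 neq0_conv)
  show "\<not> p dvd prime_free_part p Q" using y eq by simp
  show "\<exists>v. Q = p ^ v * prime_free_part p Q" using y eq by (metis mult.commute)
  show "prime_free_part p Q < Q"
    using y assms by (metis dvd_triv_left dvd_imp_le eq le_neq_implies_less)
qed

lemma gcd_determined_ignore_prime:
  assumes "prime p" "p dvd Q" "0 < Q"
  shows "gcd_determined (prime_free_part p Q) (ignore_prime p Q X)"
  using prime_free_part[OF assms] by (auto simp: gcd_determined_def ignore_prime_def)

lemma gcd_determined_ignore_prime':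
  assumes "prime p" "p dvd Q" "0 < Q"
  shows "gcd_determined Q (ignore_prime p Q X)"
proof -
  have "prime_free_part p Q dvd Q" using prime_free_part[OF assms] by (metis dvd_triv_right)
  hence "gcd (gcd n Q) (prime_free_part p Q) = gcd n (prime_free_part p Q)" for n
    by (metis gcd.assoc gcd_nat.absorb2)
  thus ?thesis using assms by (simp add: gcd_determined_def ignore_prime_def)
qed

lemma ignore_prime_iff:
  assumes "gcd_determined Q X" "prime p" "p dvd Q" "\<not> p dvd n"
  shows "n \<in> ignore_prime p Q X \<longleftrightarrow> n \<in> X"
proof -
  have Q: "0 < Q" using assms(1) by (simp add: gcd_determined_def)
  obtain v where v: "Q = p ^ v * prime_free_part p Q" using prime_free_part[OF assms(2,3) Q] by auto
  have "coprime n (p ^ v)" using assms(2,4)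
    by (metis coprime_commute coprime_power_right_iff prime_imp_coprime)
  hence "gcd n (p ^ v * R) = gcd n R" for R by (rule gcd_mult_right_left_cancel)
  from this[of "prime_free_part p Q"] have "gcd n Q = gcd n (prime_free_part p Q)"
    unfolding v[symmetric] .
  moreover have "n \<in> X \<longleftrightarrow> gcd n Q \<in> X" using assms(1) unfolding gcd_determined_def by blast
  ultimately show ?thesis unfolding ignore_prime_def by simp
qed

lemma ignore_prime_dilate:
  assumes "prime p" "p dvd Q" "0 < Q"
  shows "{n. p * n \<in> ignore_prime p Q X} = ignore_prime p Q X"
proof -
  have "coprime (prime_free_part p Q) p" using prime_free_part(3)[OF assms] assms(1)
    by (metis coprime_commute prime_imp_coprime)
  hence "gcd (p * n) (prime_free_part p Q) = gcd n (prime_free_part p Q)" for n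
    by (rule gcd_mult_left_left_cancel)
  thus ?thesis by (simp add: ignore_prime_def)
qed

lemma divisor_closed_ignore_prime: "divisor_closed X \<Longrightarrow> divisor_closed (ignore_prime p Q X)"
  unfolding divisor_closed_def ignore_prime_def
  by simp (meson dvd_refl gcd_mono)

lemma divisor_closed_dilate: "divisor_closed X \<Longrightarrow> divisor_closed {n. p * n \<in> X}"
  unfolding divisor_closed_def by (simp add: mult_dvd_mono)

text \<open>
  For a divisor-closed set the two parts of the decomposition are nested. This monotonicity is the
  source of every inequality obtained by the induction over primes.
\<close>

lemma dilate_subset_ignore_prime:
  "divisor_closed X \<Longrightarrow> {n. p * n \<in> X} \<subseteq> ignore_prime p Q X"
  unfolding divisor_closed_def ignore_prime_def by auto

text \<open>
  A mean for which divisibility by \<open>p\<close> is an event of probability \<open>w p\<close>, independent of what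
  remains after dividing by \<open>p\<close>. Natural density is the case \<open>w p = 1 / p\<close>; weighting \<open>n\<close> by
  \<open>n\<close> to the power \<open>-s\<close> and normalising by \<open>\<zeta>(s)\<close> is the case where \<open>w p\<close> is \<open>p\<close> to the
  power \<open>-s\<close>.
\<close>

locale dilation_mean =
  fixes m :: "nat set \<Rightarrow> real" and w :: "nat \<Rightarrow> real"
  assumes mean_UNIV: "m UNIV = 1"
    and mean_disjoint: "gcd_determined Q X \<Longrightarrow> gcd_determined Q Y \<Longrightarrow> X \<inter> Y = {} \<Longrightarrow>
      m (X \<union> Y) = m X + m Y"
    and mean_dilate: "prime p \<Longrightarrow> p dvd Q \<Longrightarrow> gcd_determined Q X \<Longrightarrow>
      m {n \<in> X. p dvd n} = w p * m {n. p * n \<in> X}"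
begin

lemma mean_empty: "m {} = 0"
  using mean_disjoint[of 1 "{}" "{}"] by (simp add: gcd_determined_def)

lemma mean_trivial: "gcd_determined (Suc 0) X \<Longrightarrow> X = {} \<or> X = UNIV"
  by (auto simp: gcd_determined_def)

text \<open>
  On the numbers prime to \<open>p\<close> the set \<open>X\<close> may be replaced by \<open>Y = ignore_prime p Q X\<close>. Since
  \<open>Y\<close> is invariant under division by \<open>p\<close>, its multiples of \<open>p\<close> have mean \<open>w p\<close> times that of
  \<open>Y\<close>, which leaves the factor \<open>1 - w p\<close> for the rest.
\<close>

lemma mean_split_prime:
  assumes "gcd_determined Q X" "prime p" "p dvd Q"
  shows "m X = (1 - w p) * m (ignore_prime p Q X) + w p * m {n. p * n \<in> X}"
proof -
  have Q: "0 < Q" using assms(1) by (simp add: gcd_determined_def)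
  define Y where "Y = ignore_prime p Q X"
  have Y: "gcd_determined Q Y" unfolding Y_def by (rule gcd_determined_ignore_prime'[OF assms(2,3) Q])
  let ?D = "\<lambda>X. {n \<in> X. p dvd n}"
  have R: "gcd_determined Q {n \<in> Y. \<not> p dvd n}" using Y assms(3) by (auto simp: gcd_determined_def)
  have "m ({n \<in> Y. \<not> p dvd n} \<union> ?D Y) = m {n \<in> Y. \<not> p dvd n} + m (?D Y)"
    using R gcd_determined_multiples[OF Y assms(3)] by (intro mean_disjoint) auto
  moreover have "{n \<in> Y. \<not> p dvd n} \<union> ?D Y = Y" by auto
  moreover have "m (?D Y) = w p * m Y"
    using mean_dilate[OF assms(2,3) Y] ignore_prime_dilate[OF assms(2,3) Q, of X] unfolding Y_def by simp
  moreover have "m ({n \<in> Y. \<not> p dvd n} \<union> ?D X) = m {n \<in> Y. \<not> p dvd n} + m (?D X)"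
    using R gcd_determined_multiples[OF assms(1,3)] by (intro mean_disjoint) auto
  moreover have "{n \<in> Y. \<not> p dvd n} \<union> ?D X = X"
    using ignore_prime_iff[OF assms] unfolding Y_def by auto
  moreover have "m (?D X) = w p * m {n. p * n \<in> X}" using mean_dilate[OF assms(2,3,1)] .
  ultimately show ?thesis unfolding Y_def by (simp add: algebra_simps)
qed

end

interpretation dens: dilation_mean dens "\<lambda>p. 1 / real p"
proof
  show "dens (X \<union> Y) = dens X + dens Y"
    if "gcd_determined Q X" "gcd_determined Q Y" "X \<inter> Y = {}" for Q X Y
    using dens_disjoint that gcd_determined_periodic by blast
  show "dens {n \<in> X. p dvd n} = 1 / real p * dens {n. p * n \<in> X}"
    if "prime p" "p dvd Q" "gcd_determined Q X" for p Q X
    using dens_dilate[of p "Q div p" X] gcd_determined_periodic[OF gcd_determined_dilate[OF that(3,2)]]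
      prime_gt_0_nat[OF that(1)] by simp
qed simp

lemma gcd_determined_Int: "gcd_determined Q X \<Longrightarrow> gcd_determined Q Y \<Longrightarrow> gcd_determined Q (X \<inter> Y)"
  by (auto simp: gcd_determined_def)

text \<open>
  Divisor-closed sets are positively correlated. After splitting off \<open>p\<close>, both densities are
  convex combinations \<open>(1 - t) a\<^sub>0 + t a\<^sub>1\<close> with the same \<open>t = 1 / p\<close> and with \<open>a\<^sub>1 \<le> a\<^sub>0\<close>, so
  the induction step is Chebyshev's sum inequality for two points: the error term is
  \<open>t (1 - t) (a\<^sub>0 - a\<^sub>1) (b\<^sub>0 - b\<^sub>1) \<ge> 0\<close>.
\<close>

theorem dens_correlation:
  assumes "gcd_determined Q X" "gcd_determined Q Y" "divisor_closed X" "divisor_closed Y"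
  shows "dens X * dens Y \<le> dens (X \<inter> Y)"
  using assms
proof (induction Q arbitrary: X Y rule: less_induct)
  case (less Q)
  have Q: "0 < Q" using less.prems by (simp add: gcd_determined_def)
  show ?case
  proof (cases "Q = 1")
    case True
    thus ?thesis using less.prems dens.mean_trivial[of X] dens.mean_trivial[of Y] by auto
  next
    case False
    then obtain p where p: "prime p" "p dvd Q" using prime_factor_nat by blast
    have p1: "1 < p" using p(1) prime_gt_1_nat by blast
    let ?I = "ignore_prime p Q" and ?D = "\<lambda>X. {n. p * n \<in> X}"
    define t where "t = 1 / real p"
    have t: "0 \<le> t" "t \<le> 1" using p1 by (auto simp: t_def)
    have per: "periodic (prime_free_part p Q) (?I X)" "periodic (Q div p) (?D X)"
      if "gcd_determined Q X" for X
      by (rule gcd_determined_periodic[OF gcd_determined_ignore_prime[OF p Q]],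
          rule gcd_determined_periodic[OF gcd_determined_dilate[OF that p(2)]])
    have IH0: "dens (?I X) * dens (?I Y) \<le> dens (?I (X \<inter> Y))"
    proof -
      have "?I X \<inter> ?I Y = ?I (X \<inter> Y)" by (auto simp: ignore_prime_def)
      thus ?thesis
        using less.IH[OF prime_free_part(1)[OF p Q] gcd_determined_ignore_prime[OF p Q, of X]
            gcd_determined_ignore_prime[OF p Q, of Y]]
          divisor_closed_ignore_prime[OF less.prems(3)] divisor_closed_ignore_prime[OF less.prems(4)]
        by simp
    qed
    have IH1: "dens (?D X) * dens (?D Y) \<le> dens (?D (X \<inter> Y))"
      using less.IH[of "Q div p", OF _ gcd_determined_dilate[OF less.prems(1) p(2)] gcd_determined_dilate[OF less.prems(2) p(2)]]
        divisor_closed_dilate less.prems p1 Q by (simp add: Collect_conj_eq)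
    have le: "dens (?D X) \<le> dens (?I X)" "dens (?D Y) \<le> dens (?I Y)"
      using dens_mono[OF per(2) per(1) dilate_subset_ignore_prime] less.prems by blast+
    have "dens X * dens Y = ((1 - t) * dens (?I X) + t * dens (?D X)) * ((1 - t) * dens (?I Y) + t * dens (?D Y))"
      using dens.mean_split_prime[OF less.prems(1) p] dens.mean_split_prime[OF less.prems(2) p]
      by (simp add: t_def)
    also have "\<dots> = (1 - t) * (dens (?I X) * dens (?I Y)) + t * (dens (?D X) * dens (?D Y))
        - (t * (1 - t)) * ((dens (?I X) - dens (?D X)) * (dens (?I Y) - dens (?D Y)))"
      by (simp add: algebra_simps)
    also have "\<dots> \<le> (1 - t) * (dens (?I X) * dens (?I Y)) + t * (dens (?D X) * dens (?D Y))"
      using t le by simp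
    also have "\<dots> \<le> (1 - t) * dens (?I (X \<inter> Y)) + t * dens (?D (X \<inter> Y))"
      using IH0 IH1 t by (intro add_mono mult_left_mono) auto
    also have "\<dots> = dens (X \<inter> Y)"
      using dens.mean_split_prime[OF gcd_determined_Int[OF less.prems(1,2)] p] by (simp add: t_def)
    finally show ?thesis .
  qed
qed

section \<open>The mean with weights \<open>n\<^sup>-\<^sup>s\<close>\<close>

text \<open>
  The term for \<open>n = 0\<close> vanishes, because \<open>0 powr a = 0\<close>; the sum is over the positive
  elements of \<open>X\<close>.
\<close>

definition power_sum :: "real \<Rightarrow> nat set \<Rightarrow> real" where
  "power_sum s X = (\<Sum>n. indicator X n * real n powr (- s))"

definition zeta_mean :: "real \<Rightarrow> nat set \<Rightarrow> real" where
  "zeta_mean s X = power_sum s X / power_sum s UNIV"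

lemma power_sum_summable:
  assumes "1 < s"
  shows "summable (\<lambda>n. indicator X n * real n powr (- s))"
proof (rule summable_comparison_test'[of "\<lambda>n. real n powr (- s)" 0])
  show "summable (\<lambda>n. real n powr (- s))" using assms by (simp add: summable_real_powr_iff)
qed (auto simp: indicator_def)

lemma power_sum_nonneg: "1 < s \<Longrightarrow> 0 \<le> power_sum s X"
  unfolding power_sum_def by (intro suminf_nonneg power_sum_summable) auto

lemma power_sum_disjoint:
  assumes "1 < s" "X \<inter> Y = {}"
  shows "power_sum s (X \<union> Y) = power_sum s X + power_sum s Y"
proof -
  have "power_sum s X + power_sum s Y
      = (\<Sum>n. indicator X n * real n powr (- s) + indicator Y n * real n powr (- s))"
    unfolding power_sum_def by (intro suminf_add power_sum_summable assms(1))
  also have "\<dots> = power_sum s (X \<union> Y)"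
    unfolding power_sum_def using assms(2)
    by (intro arg_cong[where f = suminf]) (auto simp: fun_eq_iff indicator_def)
  finally show ?thesis by simp
qed

lemma partial_sum_le_power_sum:
  assumes "1 < s"
  shows "(\<Sum>n\<in>X \<inter> {1..N}. real n powr (- s)) \<le> power_sum s X"
proof -
  have "(\<Sum>n\<in>X \<inter> {1..N}. real n powr (- s)) = (\<Sum>n\<in>X \<inter> {1..N}. indicator X n * real n powr (- s))"
    by (intro sum.cong) auto
  also have "\<dots> \<le> power_sum s X"
    unfolding power_sum_def using assms by (intro sum_le_suminf power_sum_summable) auto
  finally show ?thesis .
qed

lemma power_sum_le:
  assumes "1 < s" "\<And>N. (\<Sum>n\<in>X \<inter> {1..N}. real n powr (- s)) \<le> C"
  shows "power_sum s X \<le> C"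
  unfolding power_sum_def
proof (rule suminf_le_const[OF power_sum_summable[OF assms(1)]])
  fix N
  have "(\<Sum>n<N. indicator X n * real n powr (- s)) \<le> (\<Sum>n\<in>{1..N}. indicator X n * real n powr (- s))"
    by (subst (2) sum.mono_neutral_cong_left[of "{..N}"])
      (auto intro!: sum_mono2 simp: not_less_eq_eq)
  also have "\<dots> = (\<Sum>n\<in>X \<inter> {1..N}. real n powr (- s))"
    by (intro sum.mono_neutral_cong_right) (auto simp: indicator_def)
  also note assms(2)
  finally show "(\<Sum>n<N. indicator X n * real n powr (- s)) \<le> C" .
qed

lemma power_sum_mono:
  assumes "1 < s" "X \<subseteq> Y"
  shows "power_sum s X \<le> power_sum s Y"
  using power_sum_disjoint[of s X "Y - X"] power_sum_nonneg[of s "Y - X"] assms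
  by (simp add: Un_absorb1)

lemma power_sum_dilate:
  assumes "1 < s" "0 < g"
  shows "power_sum s {n \<in> X. g dvd n} = real g powr (- s) * power_sum s {n. g * n \<in> X}"
proof -
  let ?f = "\<lambda>n. indicator {n \<in> X. g dvd n} n * real n powr (- s)"
  have "power_sum s {n \<in> X. g dvd n} = (\<Sum>n. ?f (g * n))" unfolding power_sum_def
    using assms(2) by (subst suminf_mono_reindex[of "(*) g" ?f, symmetric])
      (auto simp: strict_mono_def indicator_def image_iff elim!: dvdE)
  also have "\<dots> = (\<Sum>n. real g powr (- s) * (indicator {n. g * n \<in> X} n * real n powr (- s)))"
    by (intro arg_cong[where f = suminf]) (auto simp: fun_eq_iff indicator_def powr_mult)
  also have "\<dots> = real g powr (- s) * power_sum s {n. g * n \<in> X}"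
    unfolding power_sum_def by (rule suminf_mult[OF power_sum_summable[OF assms(1)]])
  finally show ?thesis .
qed

lemma power_sum_UNIV_ge: "1 < s \<Longrightarrow> 1 \<le> power_sum s UNIV"
  using partial_sum_le_power_sum[of s UNIV 1] by simp

text \<open>
  The bound \<open>\<zeta>(s) \<le> 1 + 1 / (s - 1)\<close>. With \<open>t = s - 1\<close>, each term is dominated by a telescoping
  difference of \<open>n powr (- t) / t\<close>, which is Bernoulli's inequality for
  \<open>(1 - 1 / n) powr (- t)\<close>.
\<close>

lemma power_sum_UNIV_le:
  assumes "1 < s"
  shows "power_sum s UNIV \<le> 1 + 1 / (s - 1)"
proof (rule power_sum_le[OF assms])
  define t where "t = s - 1"
  have t: "0 < t" "s = 1 + t" using assms by (auto simp: t_def)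
  have step: "real (Suc N) powr (- s) \<le> (real N powr (- t) - real (Suc N) powr (- t)) / t"
    if "0 < N" for N
  proof -
    define M where "M = real (Suc N)"
    have M: "1 < M" "real N = M - 1" using that by (auto simp: M_def)
    have "1 / M \<le> - ln (1 - 1 / M)" using ln_add_one_self_le_self2[of "- (1 / M)"] M by simp
    hence "t * (1 / M) \<le> t * (- ln (1 - 1 / M))" using t by (intro mult_left_mono) auto
    hence "1 + t / M \<le> 1 + t * (- ln (1 - 1 / M))" by simp
    also have "\<dots> \<le> exp (t * (- ln (1 - 1 / M)))" by (rule exp_ge_add_one_self)
    also have "\<dots> = (1 - 1 / M) powr (- t)" using M by (simp add: powr_def)
    finally have "(1 + t / M) * M powr (- t) \<le> (1 - 1 / M) powr (- t) * M powr (- t)"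
      by (rule mult_right_mono) simp
    also have "\<dots> = ((1 - 1 / M) * M) powr (- t)" using M by (subst powr_mult) auto
    also have "(1 - 1 / M) * M = M - 1" using M by (simp add: field_simps)
    finally have "t * (M powr (- t) / M) \<le> (M - 1) powr (- t) - M powr (- t)"
      by (simp add: algebra_simps)
    moreover have "M powr (- s) = M powr (- t) / M"
    proof -
      have "- s = - t + (- 1)" using t(2) by simp
      thus ?thesis using M by (simp only: powr_add) (simp add: powr_minus_divide)
    qed
    ultimately show ?thesis using t(1) unfolding M(2) M_def[symmetric]
      by (simp add: pos_le_divide_eq mult.commute)
  qed
  have bound: "(\<Sum>n\<in>{1..Suc N}. real n powr (- s)) \<le> 1 + (1 - real (Suc N) powr (- t)) / t" for N
  proof (induction N)
    case (Suc N)
    have "(\<Sum>n\<in>{1..Suc (Suc N)}. real n powr (- s))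
        \<le> 1 + (1 - real (Suc N) powr (- t)) / t
          + (real (Suc N) powr (- t) - real (Suc (Suc N)) powr (- t)) / t"
      using Suc step[of "Suc N"] by simp
    thus ?case by (simp add: diff_divide_distrib)
  qed simp
  fix N
  show "(\<Sum>n\<in>UNIV \<inter> {1..N}. real n powr (- s)) \<le> 1 + 1 / (s - 1)"
  proof (cases N)
    case (Suc M)
    have "(1 - real (Suc M) powr (- t)) / t \<le> 1 / t" using t by (intro divide_right_mono) auto
    hence "(\<Sum>n\<in>{1..Suc M}. real n powr (- s)) \<le> 1 + 1 / t" using bound[of M] by linarith
    thus ?thesis unfolding Suc t_def by (simp only: Int_UNIV_left)
  qed (use assms in simp)
qed

lemma dilation_mean_zeta_mean:
  assumes "1 < s"
  shows "dilation_mean (zeta_mean s) (\<lambda>p. real p powr (- s))"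
proof
  have pos: "0 < power_sum s UNIV" using power_sum_UNIV_ge[OF assms] by simp
  show "zeta_mean s UNIV = 1" using pos by (simp add: zeta_mean_def)
  show "zeta_mean s (X \<union> Y) = zeta_mean s X + zeta_mean s Y" if "X \<inter> Y = {}" for X Y
    using that assms by (simp add: zeta_mean_def power_sum_disjoint add_divide_distrib)
  show "zeta_mean s {n \<in> X. p dvd n} = real p powr (- s) * zeta_mean s {n. p * n \<in> X}"
    if "prime p" for p X
    using prime_gt_0_nat[OF that] by (simp add: zeta_mean_def power_sum_dilate assms)
qed

text \<open>
  Raising \<open>s\<close> above 1 makes divisibility by each prime less likely, hence makes a divisor-closed
  set no less likely. In the induction over primes the weight of the smaller part \<open>{n. p n \<in> X}\<close>
  drops from \<open>t = 1 / p\<close> to \<open>u = p powr (- s)\<close>.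
\<close>

theorem dens_le_zeta_mean:
  assumes "1 < s" "gcd_determined Q X" "divisor_closed X"
  shows "dens X \<le> zeta_mean s X"
  using assms(2,3)
proof (induction Q arbitrary: X rule: less_induct)
  case (less Q)
  interpret z: dilation_mean "zeta_mean s" "\<lambda>p. real p powr (- s)"
    by (rule dilation_mean_zeta_mean[OF assms(1)])
  have Q: "0 < Q" using less.prems by (simp add: gcd_determined_def)
  show ?case
  proof (cases "Q = 1")
    case True
    thus ?thesis using less.prems z.mean_trivial[of X] z.mean_empty z.mean_UNIV by auto
  next
    case False
    then obtain p where p: "prime p" "p dvd Q" using prime_factor_nat by blast
    have p1: "1 < p" using p(1) prime_gt_1_nat by blast
    let ?I = "ignore_prime p Q X" and ?D = "{n. p * n \<in> X}"
    define t where "t = 1 / real p"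
    define u where "u = real p powr (- s)"
    have "u \<le> real p powr (- 1)" unfolding u_def using assms(1) p1 by (intro powr_mono) auto
    hence u: "0 \<le> u" "u \<le> t" "t \<le> 1" using p1 by (auto simp: u_def t_def powr_minus_divide)
    have I: "gcd_determined (prime_free_part p Q) ?I" by (rule gcd_determined_ignore_prime[OF p Q])
    have D: "gcd_determined (Q div p) ?D" by (rule gcd_determined_dilate[OF less.prems(1) p(2)])
    have le: "dens ?D \<le> dens ?I"
      by (rule dens_mono[OF gcd_determined_periodic[OF D] gcd_determined_periodic[OF I]
            dilate_subset_ignore_prime[OF less.prems(2)]])
    have "dens X = (1 - t) * dens ?I + t * dens ?D"
      using dens.mean_split_prime[OF less.prems(1) p] by (simp add: t_def)
    also have "\<dots> = (1 - u) * dens ?I + u * dens ?D - (t - u) * (dens ?I - dens ?D)"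
      by (simp add: algebra_simps)
    also have "\<dots> \<le> (1 - u) * dens ?I + u * dens ?D" using u le by simp
    also have "\<dots> \<le> (1 - u) * zeta_mean s ?I + u * zeta_mean s ?D"
      using less.IH[OF prime_free_part(1)[OF p Q] I divisor_closed_ignore_prime[OF less.prems(2)]]
        less.IH[OF _ D divisor_closed_dilate[OF less.prems(2)]] p1 Q u
      by (intro add_mono mult_left_mono) auto
    also have "\<dots> = zeta_mean s X" using z.mean_split_prime[OF less.prems(1) p] by (simp add: u_def)
    finally show ?thesis .
  qed
qed

text \<open>
  The decomposition expresses the mean through finitely many factors \<open>p powr (- s)\<close>, all of which
  are continuous at \<open>s = 1\<close>.
\<close>

theorem zeta_mean_tendsto_dens:
  assumes "gcd_determined Q X"
  shows "((\<lambda>s. zeta_mean s X) \<longlongrightarrow> dens X) (at_right 1)"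
  using assms
proof (induction Q arbitrary: X rule: less_induct)
  case (less Q)
  have Q: "0 < Q" using less.prems by (simp add: gcd_determined_def)
  have ev: "eventually (\<lambda>s::real. 1 < s) (at_right 1)" by (simp add: eventually_at_right_less)
  show ?case
  proof (cases "Q = 1")
    case True
    then consider "X = {}" | "X = UNIV" using less.prems dens.mean_trivial[of X] by auto
    thus ?thesis
    proof cases
      case 1
      show ?thesis unfolding 1
        by (rule tendsto_eventually, rule eventually_mono[OF ev])
           (simp add: dilation_mean.mean_empty[OF dilation_mean_zeta_mean])
    next
      case 2
      show ?thesis unfolding 2
        by (rule tendsto_eventually, rule eventually_mono[OF ev])
           (simp add: dilation_mean.mean_UNIV[OF dilation_mean_zeta_mean])
    qed
  next
    case False
    then obtain p where p: "prime p" "p dvd Q" using prime_factor_nat by blast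
    have p1: "1 < p" using p(1) prime_gt_1_nat by blast
    let ?I = "ignore_prime p Q X" and ?D = "{n. p * n \<in> X}"
    have I: "((\<lambda>s. zeta_mean s ?I) \<longlongrightarrow> dens ?I) (at_right 1)"
      by (rule less.IH[OF prime_free_part(1)[OF p Q] gcd_determined_ignore_prime[OF p Q]])
    have D: "((\<lambda>s. zeta_mean s ?D) \<longlongrightarrow> dens ?D) (at_right 1)"
      using less.IH[OF _ gcd_determined_dilate[OF less.prems p(2)]] p1 Q by simp
    have w: "((\<lambda>s. real p powr (- s)) \<longlongrightarrow> 1 / real p) (at_right 1)"
      using p1 by (auto intro!: tendsto_eq_intros simp: powr_minus_divide)
    have "((\<lambda>s. (1 - real p powr (- s)) * zeta_mean s ?I + real p powr (- s) * zeta_mean s ?D)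
        \<longlongrightarrow> (1 - 1 / real p) * dens ?I + 1 / real p * dens ?D) (at_right 1)"
      by (intro tendsto_intros I D w)
    also have "(1 - 1 / real p) * dens ?I + 1 / real p * dens ?D = dens X"
      using dens.mean_split_prime[OF less.prems p] by simp
    finally show ?thesis
    proof (rule Lim_transform_eventually)
      show "\<forall>\<^sub>F s in at_right 1. (1 - real p powr (- s)) * zeta_mean s ?I
          + real p powr (- s) * zeta_mean s ?D = zeta_mean s X"
        by (rule eventually_mono[OF ev])
           (simp add: dilation_mean.mean_split_prime[OF dilation_mean_zeta_mean less.prems p])
    qed
  qed
qed

section \<open>Sets of multiples\<close>

definition multiples :: "nat set \<Rightarrow> nat set" where
  "multiples A = {n. \<exists>a\<in>A. a dvd n}"

text \<open>
  The supremum of the natural densities of the sets of multiples of finite subsets. By the theorem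
  of Davenport and Erdos, proved below, it is the logarithmic density of the set of multiples, and
  all further arguments are carried out with this supremum.
\<close>

definition mult_dens :: "nat set \<Rightarrow> real" where
  "mult_dens A = (SUP F\<in>{F. finite F \<and> F \<subseteq> A}. dens (multiples F))"

definition log_sum :: "nat set \<Rightarrow> nat \<Rightarrow> real" where
  "log_sum X N = (\<Sum>n\<in>X \<inter> {1..N}. 1 / real n)"

lemma multiples_mono: "A \<subseteq> B \<Longrightarrow> multiples A \<subseteq> multiples B"
  by (auto simp: multiples_def)

lemma multiples_Un: "multiples (A \<union> B) = multiples A \<union> multiples B"
  by (auto simp: multiples_def)

lemma multiples_subset_iff: "multiples A \<subseteq> multiples B \<longleftrightarrow> A \<subseteq> multiples B"
  unfolding multiples_def by (blast intro: dvd_refl dvd_trans)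

lemma gcd_determined_multiples_of_finite:
  assumes "finite F" "F \<subseteq> {1..}"
  shows "gcd_determined (\<Prod>F) (multiples F)" "gcd_determined (\<Prod>F) (- multiples F)"
proof -
  have "0 < \<Prod>F" using assms by (intro prod_pos) (auto simp: Suc_le_eq)
  moreover have "a dvd \<Prod>F" if "a \<in> F" for a using that assms(1) by (rule dvd_prodI[rotated])
  ultimately show "gcd_determined (\<Prod>F) (multiples F)" "gcd_determined (\<Prod>F) (- multiples F)"
    by (auto simp: gcd_determined_def multiples_def)
qed

lemma divisor_closed_Compl_multiples: "divisor_closed (- multiples A)"
  by (auto simp: divisor_closed_def multiples_def dest: dvd_trans)

lemma periodic_multiples:
  "finite F \<Longrightarrow> F \<subseteq> {1..} \<Longrightarrow> periodic (\<Prod>F) (multiples F)"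
  by (intro gcd_determined_periodic gcd_determined_multiples_of_finite)

lemma mult_dens_bdd: 
  assumes "A \<subseteq> {1..}" shows "bdd_above ((\<lambda>F. dens (multiples F)) ` {F. finite F \<and> F \<subseteq> A})"
  using assms by (intro bdd_aboveI[of _ 1]) (force intro: dens_bounds periodic_multiples)

lemma dens_multiples_le:
  assumes "A \<subseteq> {1..}" "finite F" "F \<subseteq> A"
  shows "dens (multiples F) \<le> mult_dens A"
  unfolding mult_dens_def using assms by (intro cSUP_upper mult_dens_bdd) auto

lemma mult_dens_leI:
  assumes "\<And>F. finite F \<Longrightarrow> F \<subseteq> A \<Longrightarrow> dens (multiples F) \<le> c"
  shows "mult_dens A \<le> c"
  unfolding mult_dens_def using assms by (intro cSUP_least) auto

lemma mult_dens_approx: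
  assumes "A \<subseteq> {1..}" "0 < e"
  obtains F where "finite F" "F \<subseteq> A" "mult_dens A - e < dens (multiples F)"
proof -
  have "\<exists>F\<in>{F. finite F \<and> F \<subseteq> A}. mult_dens A - e < dens (multiples F)"
    unfolding mult_dens_def using assms
    by (subst less_cSUP_iff[symmetric, OF _ mult_dens_bdd]) auto
  thus thesis using that by auto
qed

lemma mult_dens_bounds:
  assumes "A \<subseteq> {1..}" shows "0 \<le> mult_dens A" "mult_dens A \<le> 1"
proof -
  show "0 \<le> mult_dens A" using dens_multiples_le[OF assms, of "{}"] by (simp add: multiples_def)
  show "mult_dens A \<le> 1"
    by (rule mult_dens_leI) (use assms in \<open>blast intro: dens_bounds periodic_multiples\<close>)
qed

lemma zeta_mean_Compl:
  assumes "1 < s" shows "zeta_mean s (- X) = 1 - zeta_mean s X"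
  using power_sum_disjoint[OF assms, of X "- X"] power_sum_UNIV_ge[OF assms]
  by (simp add: zeta_mean_def field_simps)

text \<open>
  Up to a bound \<open>N\<close>, the multiples of \<open>A\<close> are those of the finite set \<open>A \<inter> {1..N}\<close>, for which
  the mean is at most the natural density. This is where a bound uniform in \<open>s\<close> is obtained for
  infinite \<open>A\<close>.
\<close>

lemma zeta_mean_multiples_le:
  assumes "1 < s" "A \<subseteq> {1..}"
  shows "zeta_mean s (multiples A) \<le> mult_dens A"
proof -
  have pos: "0 < power_sum s UNIV" using power_sum_UNIV_ge[OF assms(1)] by simp
  have "power_sum s (multiples A) \<le> mult_dens A * power_sum s UNIV"
  proof (rule power_sum_le[OF assms(1)])
    fix N
    define F where "F = A \<inter> {1..N}"
    have F: "finite F" "F \<subseteq> A" "F \<subseteq> {1..}" using assms(2) by (auto simp: F_def)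
    have "a \<in> F" if "a \<in> A" "a dvd n" "n \<in> {1..N}" for a n
      using that assms(2) dvd_imp_le[of a n] by (auto simp: F_def)
    hence "multiples A \<inter> {1..N} = multiples F \<inter> {1..N}"
      using F(2) unfolding multiples_def by blast
    hence "(\<Sum>n\<in>multiples A \<inter> {1..N}. real n powr (- s)) \<le> power_sum s (multiples F)"
      using partial_sum_le_power_sum[OF assms(1)] by simp
    also have "\<dots> = zeta_mean s (multiples F) * power_sum s UNIV" using pos by (simp add: zeta_mean_def)
    also have "zeta_mean s (multiples F) \<le> dens (multiples F)"
      using dens_le_zeta_mean[OF assms(1) gcd_determined_multiples_of_finite(2)[OF F(1,3)]
          divisor_closed_Compl_multiples]
        dens_Compl[OF periodic_multiples[OF F(1,3)]] zeta_mean_Compl[OF assms(1)] by simp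
    also have "dens (multiples F) \<le> mult_dens A" by (rule dens_multiples_le[OF assms(2) F(1,2)])
    finally show "(\<Sum>n\<in>multiples A \<inter> {1..N}. real n powr (- s)) \<le> mult_dens A * power_sum s UNIV"
      using pos by simp
  qed
  thus ?thesis using pos by (simp add: zeta_mean_def pos_divide_le_eq)
qed

section \<open>Logarithmic sums and the theorem of Davenport and Erdos\<close>

text \<open>
  With \<open>s = 1 + 1 / ln N\<close> one has \<open>n powr (- s) \<ge> exp (-1) / n\<close> for all \<open>n \<le> N\<close>. The loss of the
  constant factor \<open>exp 1\<close> is harmless, since the bound will be applied to sets of small mean.
\<close>

lemma log_sum_le_power_sum:
  assumes "1 < N"
  shows "log_sum X N \<le> exp 1 * power_sum (1 + 1 / ln (real N)) X"
proof -
  define s where "s = 1 + 1 / ln (real N)"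
  have s: "1 < s" using assms by (simp add: s_def)
  have "1 / real n \<le> exp 1 * real n powr (- s)" if "n \<in> {1..N}" for n
  proof -
    have n: "0 < n" "n \<le> N" using that by auto
    have "ln (real n) / ln (real N) \<le> 1" using n assms by (simp add: divide_le_eq)
    hence "exp (- ln (real n)) \<le> exp (1 + (- s) * ln (real n))" by (simp add: s_def algebra_simps)
    also have "\<dots> = exp 1 * real n powr (- s)" using n by (simp add: powr_def flip: exp_add)
    finally show ?thesis using n by (simp add: exp_minus divide_inverse)
  qed
  hence "log_sum X N \<le> (\<Sum>n\<in>X \<inter> {1..N}. exp 1 * real n powr (- s))"
    unfolding log_sum_def by (intro sum_mono) auto
  also have "\<dots> \<le> exp 1 * power_sum s X"
    using partial_sum_le_power_sum[OF s, of X N] by (simp flip: sum_distrib_left)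
  finally show ?thesis by (simp add: s_def)
qed

lemma log_sum_disjoint: "X \<inter> Y = {} \<Longrightarrow> log_sum (X \<union> Y) N = log_sum X N + log_sum Y N"
  unfolding log_sum_def by (subst sum.union_disjoint[symmetric]) (auto intro: sum.cong simp: Int_Un_distrib2)

lemma log_sum_mono: "X \<subseteq> Y \<Longrightarrow> log_sum X N \<le> log_sum Y N"
  unfolding log_sum_def by (intro sum_mono2) auto

lemma log_sum_Diff: "X \<subseteq> Y \<Longrightarrow> log_sum (Y - X) N = log_sum Y N - log_sum X N"
  using log_sum_disjoint[of X "Y - X"] by (simp add: Un_absorb1)

lemma log_sum_Suc: "log_sum X (Suc N) = log_sum X N + (if Suc N \<in> X then 1 / real (Suc N) else 0)"
proof -
  have "X \<inter> {1..Suc N} = (if Suc N \<in> X then insert (Suc N) (X \<inter> {1..N}) else X \<inter> {1..N})"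
    by (auto simp: le_Suc_eq)
  thus ?thesis by (simp add: log_sum_def)
qed

lemma log_sum_0 [simp]: "log_sum X 0 = 0" by (simp add: log_sum_def)

lemma log_sum_UNIV: "log_sum UNIV N = harm N"
  by (simp add: log_sum_def harm_def field_simps)

lemma harm_le_ln: "1 \<le> N \<Longrightarrow> harm N \<le> 1 + ln (real N)"
proof (induction N rule: nat_induct_at_least)
  case base show ?case by (simp add: harm_def)
next
  case (Suc N)
  have "1 - 1 / real (Suc N) = real N / real (Suc N)" by (simp add: field_simps)
  hence "inverse (real (Suc N)) \<le> ln (real (Suc N)) - ln (real N)"
    using ln_add_one_self_le_self2[of "- (1 / real (Suc N))"] Suc.hyps
    by (simp add: ln_div inverse_eq_divide)
  thus ?case using Suc by (simp add: harm_Suc)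
qed

text \<open>
  Partial summation. The induction carries the term \<open>S n / n\<close> along, where \<open>S n\<close> is the deviation
  of the counting function from \<open>c n\<close>; the increments then telescope against the positive
  differences \<open>1 / n - 1 / (n + 1)\<close>.
\<close>

lemma log_sum_deviation:
  assumes "\<And>n. real (count_upto X n) \<le> c * real n + C" "0 \<le> C"
  shows "log_sum X N \<le> c * harm N + C"
proof -
  define S where "S n = real (count_upto X n) - c * real n" for n
  have main: "log_sum X (Suc n) - c * harm (Suc n) - S (Suc n) / real (Suc n) \<le> C * (1 - 1 / real (Suc n))" for n
  proof (induction n)
    case 0 show ?case by (simp add: log_sum_Suc S_def count_upto_Suc harm_def)
  next
    case (Suc n)
    define M where "M = real (Suc n)"
    have M: "0 < M" by (simp add: M_def)
    define b :: real where "b = (if Suc (Suc n) \<in> X then 1 else 0)"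
    have M1: "real (Suc (Suc n)) = M + 1" by (simp add: M_def)
    have S': "S (Suc (Suc n)) = S (Suc n) + b - c"
      by (simp add: S_def b_def count_upto_Suc[of X "Suc n"] algebra_simps)
    have log': "log_sum X (Suc (Suc n)) = log_sum X (Suc n) + b / (M + 1)"
      unfolding log_sum_Suc[of X "Suc n"] M1 b_def by simp
    have harm': "harm (Suc (Suc n)) = harm (Suc n) + 1 / (M + 1)"
      unfolding harm_Suc[of "Suc n"] M1 by (simp add: inverse_eq_divide)
    have "log_sum X (Suc (Suc n)) - c * harm (Suc (Suc n)) - S (Suc (Suc n)) / real (Suc (Suc n))
       = (log_sum X (Suc n) - c * harm (Suc n) - S (Suc n) / M) + S (Suc n) * (1 / M - 1 / (M + 1))"
      unfolding M1 S' log' harm'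
      by (simp add: diff_divide_distrib add_divide_distrib distrib_left right_diff_distrib)
    also have "\<dots> \<le> C * (1 - 1 / M) + C * (1 / M - 1 / (M + 1))"
    proof (intro add_mono mult_right_mono)
      show "S (Suc n) \<le> C" using assms(1)[of "Suc n"] by (simp add: S_def)
      show "0 \<le> 1 / M - 1 / (M + 1)" using M by (simp add: frac_le)
    qed (use Suc in \<open>simp add: M_def\<close>)
    also have "\<dots> = C * (1 - 1 / (M + 1))" by (simp add: right_diff_distrib)
    finally show ?case unfolding M1 .
  qed
  have *: "log_sum X (Suc n) \<le> c * harm (Suc n) + C" for n
  proof -
    have "S (Suc n) \<le> C" using assms(1)[of "Suc n"] by (simp add: S_def)
    hence "S (Suc n) / real (Suc n) \<le> C / real (Suc n)" by (rule divide_right_mono) simp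
    moreover have "C * (1 - 1 / real (Suc n)) = C - C / real (Suc n)" by (simp add: right_diff_distrib)
    ultimately show ?thesis using main[of n] by linarith
  qed
  show ?thesis
  proof (cases N)
    case 0 thus ?thesis using assms(2) by (simp add: harm_def)
  qed (use * in auto)
qed

lemma tendsto_harm_over_ln: "(\<lambda>N. harm N / ln (real N)) \<longlonglongrightarrow> 1"
proof (rule tendsto_sandwich)
  show "\<forall>\<^sub>F N in sequentially. 1 \<le> harm N / ln (real N)"
    using eventually_gt_at_top[of 1]
  proof eventually_elim
    case (elim N)
    have "ln (real N) \<le> ln (real N + 1)" using elim by simp
    hence "ln (real N) \<le> harm N" using ln_le_harm[of N] by linarith
    thus ?case using elim by (simp add: le_divide_eq)
  qed
  show "\<forall>\<^sub>F N in sequentially. harm N / ln (real N) \<le> (1 + ln (real N)) / ln (real N)"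
    using eventually_gt_at_top[of 1]
    by eventually_elim (auto intro!: divide_right_mono harm_le_ln)
qed (rule tendsto_const, real_asymp)

lemma log_sum_periodic:
  assumes "periodic Q X"
  shows "(\<lambda>N. log_sum X N / ln (real N)) \<longlonglongrightarrow> dens X"
proof -
  have dev: "\<bar>real (count_upto X N) - dens X * real N\<bar> \<le> real Q" for N
    by (rule count_upto_dens[OF assms])
  have up: "log_sum X N \<le> dens X * harm N + real Q" for N
    using dev by (intro log_sum_deviation) (auto simp: abs_le_iff algebra_simps)
  have "real (count_upto (- X) N) \<le> (1 - dens X) * real N + real Q" for N
  proof -
    have "real (count_upto X N) + real (count_upto (- X) N) = real N"
      using count_upto_disjoint[of X "- X" N] by (simp add: count_upto_def)
    thus ?thesis using dev[of N] by (simp add: abs_le_iff algebra_simps)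
  qed
  hence compl: "log_sum (- X) N \<le> (1 - dens X) * harm N + real Q" for N
    by (intro log_sum_deviation) auto
  have low: "log_sum X N \<ge> dens X * harm N - real Q" for N
  proof -
    have "log_sum X N + log_sum (- X) N = harm N"
      using log_sum_disjoint[of X "- X" N] log_sum_UNIV[of N] by simp
    thus ?thesis using compl[of N] by (simp add: left_diff_distrib)
  qed
  have Q: "(\<lambda>N. real Q / ln (real N)) \<longlonglongrightarrow> 0" by real_asymp
  show ?thesis
  proof (rule tendsto_sandwich)
    show "\<forall>\<^sub>F N in sequentially. dens X * (harm N / ln (real N)) - real Q / ln (real N) \<le> log_sum X N / ln (real N)"
      using eventually_gt_at_top[of 1]
      by eventually_elim (use low in \<open>auto intro!: divide_right_mono simp flip: diff_divide_distrib\<close>)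
    show "\<forall>\<^sub>F N in sequentially. log_sum X N / ln (real N) \<le> dens X * (harm N / ln (real N)) + real Q / ln (real N)"
      using eventually_gt_at_top[of 1]
      by eventually_elim (use up in \<open>auto intro!: divide_right_mono simp flip: add_divide_distrib\<close>)
    show "(\<lambda>N. dens X * (harm N / ln (real N)) - real Q / ln (real N)) \<longlonglongrightarrow> dens X"
      using tendsto_diff[OF tendsto_mult_left[OF tendsto_harm_over_ln, of "dens X"] Q] by simp
    show "(\<lambda>N. dens X * (harm N / ln (real N)) + real Q / ln (real N)) \<longlonglongrightarrow> dens X"
      using tendsto_add[OF tendsto_mult_left[OF tendsto_harm_over_ln, of "dens X"] Q] by simp
  qed
qed

text \<open>
  A finite \<open>F \<subseteq> A\<close> with \<open>dens (multiples F)\<close> close to the supremum accounts for almost all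
  multiples of \<open>A\<close>. The multiples of \<open>F\<close> have a logarithmic density because they form a periodic
  set. The remaining set \<open>multiples A - multiples F\<close> has logarithmic sum up to \<open>N\<close> at most
  \<open>exp 1 * \<zeta>(s)\<close> times the difference of the means of the two sets of multiples at
  \<open>s = 1 + 1 / ln N\<close>. Here \<open>\<zeta>(s) \<le> 1 + ln N\<close>, the mean of \<open>multiples A\<close> is at most the
  supremum, and that of \<open>multiples F\<close> tends to its density as \<open>N\<close> grows.
\<close>

theorem davenport_erdos:
  assumes "A \<subseteq> {1..}"
  shows "(\<lambda>N. log_sum (multiples A) N / ln (real N)) \<longlonglongrightarrow> mult_dens A"
proof (rule LIMSEQ_I)
  fix e :: real assume e: "0 < e"
  \<comment> \<open>The constant 12 leaves \<open>exp 1 * (e / 12) < e / 2\<close>.\<close>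
  obtain F where F: "finite F" "F \<subseteq> A" "mult_dens A - e / 12 < dens (multiples F)"
    using mult_dens_approx[OF assms, of "e / 12"] e by auto
  have F1: "F \<subseteq> {1..}" using F assms by auto
  have Fle: "dens (multiples F) \<le> mult_dens A" by (rule dens_multiples_le[OF assms F(1,2)])
  define s where "s N = 1 + 1 / ln (real N)" for N
  have "filterlim s (at_right 1) sequentially" unfolding s_def by real_asymp
  with zeta_mean_tendsto_dens[OF gcd_determined_multiples_of_finite(1)[OF F(1) F1]]
  have "(\<lambda>N. zeta_mean (s N) (multiples F)) \<longlonglongrightarrow> dens (multiples F)"
    by (rule filterlim_compose)
  hence "(\<lambda>N. exp 1 * ((1 + ln (real N)) / ln (real N)) * (mult_dens A - zeta_mean (s N) (multiples F)))
      \<longlonglongrightarrow> exp 1 * 1 * (mult_dens A - dens (multiples F))"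
    by (intro tendsto_intros) real_asymp+
  moreover have "exp 1 * 1 * (mult_dens A - dens (multiples F)) < e / 2"
  proof -
    have "exp 1 * (mult_dens A - dens (multiples F)) \<le> 3 * (mult_dens A - dens (multiples F))"
      using Fle exp_le by (intro mult_right_mono) auto
    thus ?thesis using F(3) e by simp
  qed
  ultimately have ev1: "\<forall>\<^sub>F N in sequentially. exp 1 * ((1 + ln (real N)) / ln (real N))
      * (mult_dens A - zeta_mean (s N) (multiples F)) < e / 2"
    by (rule order_tendstoD)
  have lim: "(\<lambda>N. log_sum (multiples F) N / ln (real N)) \<longlonglongrightarrow> dens (multiples F)"
    by (rule log_sum_periodic[OF periodic_multiples[OF F(1) F1]])
  have ev2: "\<forall>\<^sub>F N in sequentially. log_sum (multiples F) N / ln (real N) < dens (multiples F) + e / 2"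
    using lim e by (intro order_tendstoD) auto
  have ev3: "\<forall>\<^sub>F N in sequentially. dens (multiples F) - e / 2 < log_sum (multiples F) N / ln (real N)"
    using lim e by (intro order_tendstoD) auto
  have "\<forall>\<^sub>F N in sequentially. norm (log_sum (multiples A) N / ln (real N) - mult_dens A) < e"
    using ev1 ev2 ev3 eventually_gt_at_top[of 1]
  proof eventually_elim
    case (elim N)
    have lnN: "0 < ln (real N)" using elim by simp
    have s: "1 < s N" using lnN by (simp add: s_def)
    let ?z = "power_sum (s N)"
    have pos: "0 < ?z UNIV" using power_sum_UNIV_ge[OF s] by simp
    have sub: "multiples F \<subseteq> multiples A" by (rule multiples_mono[OF F(2)])
    have "log_sum (multiples A - multiples F) N \<le> exp 1 * ?z (multiples A - multiples F)"
      unfolding s_def using elim by (intro log_sum_le_power_sum) simp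
    also have "?z (multiples A - multiples F) = ?z (multiples A) - ?z (multiples F)"
      using power_sum_disjoint[OF s, of "multiples F" "multiples A - multiples F"] sub
      by (simp add: Un_absorb1)
    also have "\<dots> = ?z UNIV * (zeta_mean (s N) (multiples A) - zeta_mean (s N) (multiples F))"
      using pos by (simp add: zeta_mean_def field_simps)
    also have "\<dots> \<le> (1 + ln (real N)) * (mult_dens A - zeta_mean (s N) (multiples F))"
    proof (intro mult_mono)
      show "?z UNIV \<le> 1 + ln (real N)" using power_sum_UNIV_le[OF s] by (simp add: s_def)
      have "zeta_mean (s N) (multiples F) \<le> zeta_mean (s N) (multiples A)"
        using power_sum_mono[OF s sub] pos by (simp add: zeta_mean_def divide_right_mono)
      thus "0 \<le> zeta_mean (s N) (multiples A) - zeta_mean (s N) (multiples F)" by simp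
    qed (use zeta_mean_multiples_le[OF s assms] lnN in auto)
    finally have "log_sum (multiples A - multiples F) N / ln (real N)
        \<le> exp 1 * ((1 + ln (real N)) / ln (real N)) * (mult_dens A - zeta_mean (s N) (multiples F))"
      using lnN by (simp add: field_simps)
    hence "log_sum (multiples A) N / ln (real N) \<le> log_sum (multiples F) N / ln (real N) + e / 2"
      using elim(1) unfolding log_sum_Diff[OF sub] diff_divide_distrib by linarith
    moreover have "log_sum (multiples F) N / ln (real N) \<le> log_sum (multiples A) N / ln (real N)"
      using lnN by (intro divide_right_mono log_sum_mono sub) simp
    ultimately show ?case using elim(2,3) F(3) Fle unfolding real_norm_def by linarith
  qed
  thus "\<exists>N0. \<forall>N\<ge>N0. norm (log_sum (multiples A) N / ln (real N) - mult_dens A) < e"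
    by (simp add: eventually_sequentially)
qed

section \<open>Density of sets of multiples\<close>

lemma in_multiples_of: "m \<in> multiples_of A \<longleftrightarrow> (\<exists>a\<in>A. int a dvd m)"
  by (simp add: multiples_of_def dvd_def)

lemma of_nat_in_multiples_of: "int n \<in> multiples_of A \<longleftrightarrow> n \<in> multiples A"
  by (simp add: in_multiples_of multiples_def)

lemma multiplesI: "a \<in> A \<Longrightarrow> a dvd n \<Longrightarrow> n \<in> multiples A"
  unfolding multiples_def by blast

lemma log_density_multiples_of:
  assumes "A \<subseteq> {1..}"
  shows "log_density (multiples_of A) = mult_dens A"
proof -
  have "(\<Sum>a\<in>multiples_of A \<inter> {1..int N}. 1 / real_of_int a) = log_sum (multiples A) N" for N
  proof -
    have "multiples_of A \<inter> {1..int N} = int ` (multiples A \<inter> {1..N})"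
    proof (intro set_eqI iffI)
      fix m assume m: "m \<in> multiples_of A \<inter> {1..int N}"
      then obtain n where "m = int n" by (metis IntD2 atLeastAtMost_iff order_trans zero_le_one zero_le_imp_eq_int)
      thus "m \<in> int ` (multiples A \<inter> {1..N})" using m by (simp add: of_nat_in_multiples_of image_iff)
    qed (auto simp: of_nat_in_multiples_of)
    thus ?thesis by (simp add: log_sum_def sum.reindex)
  qed
  thus ?thesis using limI[OF davenport_erdos[OF assms]] by (simp add: log_density_def)
qed

lemma taut_iff:
  assumes "A \<subseteq> {1..}"
  shows "taut A \<longleftrightarrow> (\<forall>b\<in>A. mult_dens (A - {b}) < mult_dens A)"
proof -
  have "log_density (multiples_of (A - {b})) = mult_dens (A - {b})" for b
    using assms by (intro log_density_multiples_of) auto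
  thus ?thesis using log_density_multiples_of[OF assms] by (simp add: taut_def)
qed

lemma mult_dens_mono:
  assumes "A \<subseteq> {1..}" "B \<subseteq> {1..}" "A \<subseteq> multiples B"
  shows "mult_dens A \<le> mult_dens B"
proof (rule LIMSEQ_le[OF davenport_erdos[OF assms(1)] davenport_erdos[OF assms(2)]])
  have "log_sum (multiples A) N / ln (real N) \<le> log_sum (multiples B) N / ln (real N)" if "1 \<le> N" for N
    using that assms(3) by (intro divide_right_mono log_sum_mono) (auto simp: multiples_subset_iff)
  thus "\<exists>N. \<forall>n\<ge>N. log_sum (multiples A) n / ln (real n) \<le> log_sum (multiples B) n / ln (real n)" by blast
qed

lemma subset_multiples: "A \<subseteq> multiples A"
  by (auto intro: multiplesI)

lemma mult_dens_subset: "B \<subseteq> {1..} \<Longrightarrow> A \<subseteq> B \<Longrightarrow> mult_dens A \<le> mult_dens B"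
  using subset_multiples[of B] by (intro mult_dens_mono) auto

lemma mult_dens_modular:
  assumes "X \<subseteq> {1..}" "Y \<subseteq> {1..}" "Z \<subseteq> {1..}" "multiples Z = multiples X \<inter> multiples Y"
  shows "mult_dens (X \<union> Y) + mult_dens Z = mult_dens X + mult_dens Y"
proof (rule LIMSEQ_unique)
  have XY: "X \<union> Y \<subseteq> {1..}" using assms by auto
  have "log_sum (multiples (X \<union> Y)) N + log_sum (multiples Z) N
      = log_sum (multiples X) N + log_sum (multiples Y) N" for N
    unfolding log_sum_def assms(4) multiples_Un
    using sum.union_inter[of "multiples X \<inter> {1..N}" "multiples Y \<inter> {1..N}" "\<lambda>n. 1 / real n"]
    unfolding Int_Un_distrib2 by (simp add: Int_ac)
  moreover have "(\<lambda>N. log_sum (multiples (X \<union> Y)) N / ln (real N) + log_sum (multiples Z) N / ln (real N))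
      \<longlonglongrightarrow> mult_dens (X \<union> Y) + mult_dens Z"
    by (intro tendsto_add davenport_erdos XY assms)
  ultimately show "(\<lambda>N. log_sum (multiples X) N / ln (real N) + log_sum (multiples Y) N / ln (real N))
      \<longlonglongrightarrow> mult_dens (X \<union> Y) + mult_dens Z"
    by (simp flip: add_divide_distrib)
  show "(\<lambda>N. log_sum (multiples X) N / ln (real N) + log_sum (multiples Y) N / ln (real N))
      \<longlonglongrightarrow> mult_dens X + mult_dens Y"
    by (intro tendsto_add davenport_erdos assms)
qed

lemma mult_dens_finite:
  assumes "finite F" "F \<subseteq> {1..}"
  shows "mult_dens F = dens (multiples F)"
  using LIMSEQ_unique[OF davenport_erdos[OF assms(2)] log_sum_periodic[OF periodic_multiples[OF assms]]] .

lemma mult_dens_singleton: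
  assumes "1 \<le> g"
  shows "mult_dens {g} = 1 / real g"
proof -
  have "dens {n \<in> UNIV. g dvd n} = dens {n. g * n \<in> UNIV} / real g"
    using assms by (intro dens_dilate[of g 1]) (auto simp: periodic_def)
  thus ?thesis using assms by (simp add: mult_dens_finite multiples_def)
qed

lemma dens_multiples_scale:
  assumes "1 \<le> g" "finite F" "F \<subseteq> {1..}"
  shows "dens (multiples ((*) g ` F)) = dens (multiples F) / real g"
proof -
  have 1: "{n \<in> multiples ((*) g ` F). g dvd n} = multiples ((*) g ` F)"
    by (auto simp: multiples_def dest: dvd_mult_left)
  have 2: "{n. g * n \<in> multiples ((*) g ` F)} = multiples F"
    using assms(1) by (auto simp: multiples_def)
  show ?thesis
    using dens_dilate[of g "\<Prod>F" "multiples ((*) g ` F)"] assms periodic_multiples[OF assms(2,3)]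
    unfolding 1 2 by simp
qed

lemma mult_dens_scale:
  assumes "1 \<le> g" "A \<subseteq> {1..}"
  shows "mult_dens ((*) g ` A) = mult_dens A / real g"
proof (rule antisym)
  have gA: "(*) g ` A \<subseteq> {1..}" using assms by (auto simp: Suc_le_eq)
  show "mult_dens ((*) g ` A) \<le> mult_dens A / real g"
  proof (rule mult_dens_leI)
    fix F assume "finite F" "F \<subseteq> (*) g ` A"
    then obtain F' where F': "F' \<subseteq> A" "finite F'" "F = (*) g ` F'" by (metis finite_subset_image)
    thus "dens (multiples F) \<le> mult_dens A / real g"
      using dens_multiples_scale[of g F'] dens_multiples_le[OF assms(2) F'(2,1)] assms
      by (auto intro: divide_right_mono)
  qed
  have "mult_dens A \<le> real g * mult_dens ((*) g ` A)"
  proof (rule mult_dens_leI)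
    fix F assume F: "finite F" "F \<subseteq> A"
    hence "dens (multiples F) / real g \<le> mult_dens ((*) g ` A)"
      using dens_multiples_scale[of g F] dens_multiples_le[OF gA, of "(*) g ` F"] assms by auto
    thus "dens (multiples F) \<le> real g * mult_dens ((*) g ` A)" using assms(1) by (simp add: field_simps)
  qed
  thus "mult_dens A / real g \<le> mult_dens ((*) g ` A)" using assms(1) by (simp add: field_simps)
qed

lemma gcd_determined_dvd:
  assumes "gcd_determined Q X" "Q dvd R" "0 < R"
  shows "gcd_determined R X"
proof -
  have "gcd (gcd n R) Q = gcd n Q" for n using assms(2) by (metis gcd.assoc gcd_nat.absorb2)
  thus ?thesis using assms unfolding gcd_determined_def by metis
qed

text \<open>
  The inequality of Heilbronn, Rohrbach and Behrend: the complements of the sets of multiples of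
  finite sets are divisor-closed, hence positively correlated, and suprema preserve the estimate.
\<close>

theorem behrend_inequality:
  assumes "X \<subseteq> {1..}" "Y \<subseteq> {1..}"
  shows "(1 - mult_dens X) * (1 - mult_dens Y) \<le> 1 - mult_dens (X \<union> Y)"
proof -
  have "mult_dens (X \<union> Y) \<le> 1 - (1 - mult_dens X) * (1 - mult_dens Y)"
  proof (rule mult_dens_leI)
    fix F assume F: "finite F" "F \<subseteq> X \<union> Y"
    define G H where "G = F \<inter> X" and "H = F \<inter> Y"
    have G: "finite G" "G \<subseteq> X" "G \<subseteq> {1..}" and H: "finite H" "H \<subseteq> Y" "H \<subseteq> {1..}"
      using F assms by (auto simp: G_def H_def)
    have Fs: "F \<subseteq> {1..}" using F assms by auto
    have FGH: "- multiples F = - multiples G \<inter> - multiples H"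
    proof -
      have "F = G \<union> H" using F by (auto simp: G_def H_def)
      thus ?thesis by (simp add: multiples_Un)
    qed
    have "0 < \<Prod>G * \<Prod>H" using G H by (auto intro!: prod_pos simp: Suc_le_eq)
    hence "gcd_determined (\<Prod>G * \<Prod>H) (- multiples G)" "gcd_determined (\<Prod>G * \<Prod>H) (- multiples H)"
      by (auto intro: gcd_determined_dvd[OF gcd_determined_multiples_of_finite(2)[OF G(1,3)]]
          gcd_determined_dvd[OF gcd_determined_multiples_of_finite(2)[OF H(1,3)]])
    from dens_correlation[OF this divisor_closed_Compl_multiples divisor_closed_Compl_multiples]
    have "(1 - dens (multiples G)) * (1 - dens (multiples H)) \<le> 1 - dens (multiples F)"
      unfolding FGH[symmetric] using dens_Compl periodic_multiples G H F(1) Fs by metis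
    moreover have "(1 - mult_dens X) * (1 - mult_dens Y) \<le> (1 - dens (multiples G)) * (1 - dens (multiples H))"
      using dens_multiples_le[OF assms(1) G(1,2)] dens_multiples_le[OF assms(2) H(1,2)]
        mult_dens_bounds[OF assms(1)] mult_dens_bounds[OF assms(2)] by (intro mult_mono) auto
    ultimately show "dens (multiples F) \<le> 1 - (1 - mult_dens X) * (1 - mult_dens Y)" by linarith
  qed
  thus ?thesis by simp
qed

lemma mult_dens_empty [simp]: "mult_dens {} = 0"
  by (simp add: mult_dens_finite multiples_def)

text \<open>
  A set \<open>A\<close> with \<open>mult_dens A = 1\<close> is called Behrend. A union of two sets that are not Behrend is
  not Behrend, because the product of the two positive densities of the complements is positive.
\<close>

lemma behrend_finite_Union:
  assumes "finite I" "\<And>i. i \<in> I \<Longrightarrow> X i \<subseteq> {1..}" "mult_dens (\<Union>i\<in>I. X i) = 1"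
  shows "\<exists>i\<in>I. mult_dens (X i) = 1"
  using assms
proof (induction I rule: finite_induct)
  case (insert i I)
  have sub: "X i \<subseteq> {1..}" "(\<Union>i\<in>I. X i) \<subseteq> {1..}" using insert.prems(1) by blast+
  have "(1 - mult_dens (X i)) * (1 - mult_dens (\<Union>i\<in>I. X i)) \<le> 0"
    using behrend_inequality[OF sub] insert.prems(2) by simp
  hence "mult_dens (X i) = 1 \<or> mult_dens (\<Union>i\<in>I. X i) = 1"
    using mult_dens_bounds[OF sub(1)] mult_dens_bounds[OF sub(2)]
    by (smt (verit) mult_pos_pos)
  thus ?case using insert by auto
qed simp

text \<open>
  If adding \<open>b\<close> does not increase the density, then almost every multiple of \<open>b\<close> is a multiple of
  an element of \<open>A\<close>. Now \<open>a\<close> divides \<open>b m\<close> exactly if \<open>a / gcd a b\<close> divides \<open>m\<close>, so the set of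
  all \<open>a / gcd a b\<close> is Behrend. It splits into finitely many parts according to the value
  \<open>g = gcd a b\<close>; one of them is Behrend, and multiplying this part by \<open>g\<close> gives elements of \<open>A\<close>
  whose multiples fill almost all of the multiples of \<open>g\<close>.
\<close>

lemma scaled_Behrend_part:
  assumes "A \<subseteq> {1..}" "1 \<le> b" "mult_dens (insert b A) = mult_dens A"
  obtains g where "g dvd b" "mult_dens {a \<in> A. gcd a b = g} = 1 / real g"
proof -
  define q where "q a = a div gcd a b" for a
  have q: "1 \<le> q a" "a = gcd a b * q a" if "a \<in> A" for a
  proof -
    have a: "0 < a" using that assms(1) by (auto simp: Suc_le_eq)
    show eq: "a = gcd a b * q a" by (simp add: q_def)
    show "1 \<le> q a" using a by (subst (asm) eq) (auto simp: Suc_le_eq)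
  qed
  have dvd_iff: "a dvd b * m \<longleftrightarrow> q a dvd m" if "a \<in> A" for a m
  proof -
    have g: "0 < gcd a b" using assms(2) by simp
    have "coprime (q a) (b div gcd a b)" unfolding q_def using assms(2) by (intro div_gcd_coprime) auto
    moreover have "a dvd b * m \<longleftrightarrow> gcd a b * q a dvd gcd a b * ((b div gcd a b) * m)"
      using q(2)[OF that] by (simp flip: mult.assoc)
    moreover have "gcd a b * q a dvd gcd a b * ((b div gcd a b) * m) \<longleftrightarrow> q a dvd (b div gcd a b) * m"
      using g by (metis nat_mult_dvd_cancel1)
    ultimately show ?thesis by (metis coprime_dvd_mult_right_iff)
  qed
  have qA: "q ` A \<subseteq> {1..}" using q by auto
  have bqA: "(*) b ` q ` A \<subseteq> {1..}" using qA assms(2) by (auto simp: Suc_le_eq)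
  have "multiples ((*) b ` q ` A) = multiples {b} \<inter> multiples A"
  proof (intro set_eqI iffI)
    fix n assume "n \<in> multiples ((*) b ` q ` A)"
    then obtain a where a: "a \<in> A" "b * q a dvd n" by (auto simp: multiples_def)
    then obtain m where "n = b * (q a * m)" unfolding dvd_def by (auto simp: mult.assoc)
    thus "n \<in> multiples {b} \<inter> multiples A"
      using multiplesI[OF a(1)] dvd_iff[OF a(1)] by (simp add: multiplesI)
  next
    fix n assume "n \<in> multiples {b} \<inter> multiples A"
    then obtain a where a: "a \<in> A" "a dvd n" "b dvd n" by (auto simp: multiples_def)
    then obtain m where m: "n = b * m" by (auto elim: dvdE)
    have "q a dvd m" using a dvd_iff[OF a(1), of m] by (simp add: m)
    thus "n \<in> multiples ((*) b ` q ` A)"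
      using a(1) m by (intro multiplesI[of "b * q a"]) (auto intro: mult_dvd_mono)
  qed
  hence "mult_dens ({b} \<union> A) + mult_dens ((*) b ` q ` A) = mult_dens {b} + mult_dens A"
    using assms bqA by (intro mult_dens_modular) auto
  hence "mult_dens (q ` A) = 1"
    using assms(2,3) by (simp add: mult_dens_scale[OF assms(2) qA] mult_dens_singleton)
  moreover define X where "X g = q ` {a \<in> A. gcd a b = g}" for g
  moreover have "q ` A = (\<Union>g\<in>{g. g dvd b}. X g)" by (auto simp: X_def)
  moreover have X: "X g \<subseteq> {1..}" for g using qA by (auto simp: X_def)
  ultimately obtain g where g: "g dvd b" "mult_dens (X g) = 1"
    using behrend_finite_Union[of "{g. g dvd b}" X] assms(2) by auto
  have "(*) g ` X g = {a \<in> A. gcd a b = g}"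
    unfolding X_def image_image using q(2) by force
  moreover have "1 \<le> g" using g(1) assms(2) by (auto simp: Suc_le_eq intro!: Nat.gr0I)
  ultimately have "mult_dens {a \<in> A. gcd a b = g} = 1 / real g"
    using mult_dens_scale[of g "X g"] X g(2) by simp
  thus thesis using that g(1) by blast
qed

section \<open>Taut sets\<close>

text \<open>
  The positive integers almost all of whose multiples lie in the set of multiples of \<open>B\<close>. The taut
  set attached to \<open>B\<close> consists of the minimal elements of the saturation for divisibility.
\<close>

definition saturation :: "nat set \<Rightarrow> nat set" where
  "saturation B = {c. 1 \<le> c \<and> mult_dens (insert c B) = mult_dens B}"

definition primitive_core :: "nat set \<Rightarrow> nat set" where
  "primitive_core A = {b \<in> A. \<forall>a\<in>A. a dvd b \<longrightarrow> a = b}"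

lemma multiples_primitive_core:
  assumes "A \<subseteq> {1..}"
  shows "multiples (primitive_core A) = multiples A"
proof
  show "multiples (primitive_core A) \<subseteq> multiples A"
    by (rule multiples_mono) (auto simp: primitive_core_def)
  have "a \<in> multiples (primitive_core A)" if "a \<in> A" for a
    using that
  proof (induction a rule: less_induct)
    case (less a)
    show ?case
    proof (cases "a \<in> primitive_core A")
      case False
      then obtain a' where a': "a' \<in> A" "a' dvd a" "a' \<noteq> a" using less.prems by (auto simp: primitive_core_def)
      hence "a' < a" using less.prems assms by (metis atLeast_iff dvd_imp_le le_neq_implies_less
            not_one_le_zero not_gr_zero subsetD)
      from less.IH[OF this a'(1)] show ?thesis using a'(2) by (auto simp: multiples_def intro: dvd_trans)
    qed (auto intro: multiplesI)
  qed
  thus "multiples A \<subseteq> multiples (primitive_core A)" by (auto simp: multiples_subset_iff)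
qed

lemma subset_saturation: "B \<subseteq> {1..} \<Longrightarrow> B \<subseteq> saturation B"
  by (auto simp: saturation_def insert_absorb)

lemma saturation_subset: "saturation B \<subseteq> {1..}"
  by (auto simp: saturation_def)

text \<open>
  The multiples of \<open>c\<close> outside \<open>multiples B\<close> have logarithmic density zero, hence so have those
  outside the larger set \<open>multiples A\<close>. In terms of densities this is modularity for
  \<open>insert c B\<close> and \<open>A\<close>, because the common multiples of both sets include all multiples of \<open>B\<close>.
\<close>

lemma mult_dens_insert_null:
  assumes "A \<subseteq> {1..}" "B \<subseteq> A" "c \<in> saturation B"
  shows "mult_dens (insert c A) = mult_dens A"
proof -
  have c: "1 \<le> c" "mult_dens (insert c B) = mult_dens B" using assms(3) by (auto simp: saturation_def)
  have B: "B \<subseteq> {1..}" using assms by auto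
  define X where "X = insert c B"
  \<comment> \<open>The intersection of two sets of multiples is generated by its own positive elements.\<close>
  define Z where "Z = multiples X \<inter> multiples A \<inter> {1..}"
  have X: "X \<subseteq> {1..}" using B c by (auto simp: X_def)
  have zero: "0 \<in> multiples Z" if "a \<in> A" for a
  proof -
    have "a * c \<in> Z" using that assms(1) c(1)
      by (auto simp: Z_def X_def Suc_le_eq intro: multiplesI[of a] multiplesI[of c])
    thus ?thesis by (auto simp: multiples_def)
  qed
  have "multiples Z = multiples X \<inter> multiples A"
  proof
    show "multiples Z \<subseteq> multiples X \<inter> multiples A"
      unfolding Z_def multiples_def by (blast intro: dvd_trans)
    show "multiples X \<inter> multiples A \<subseteq> multiples Z"
    proof
      fix n assume n: "n \<in> multiples X \<inter> multiples A"
      show "n \<in> multiples Z"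
      proof (cases "n = 0")
        case True
        obtain a where "a \<in> A" using n by (auto simp: multiples_def)
        thus ?thesis using zero True by simp
      next
        case False
        hence "n \<in> Z" using n by (simp add: Z_def)
        thus ?thesis by (rule multiplesI) simp
      qed
    qed
  qed
  from mult_dens_modular[OF X assms(1) _ this]
  have "mult_dens (X \<union> A) + mult_dens Z = mult_dens B + mult_dens A"
    using c(2) by (simp add: Z_def X_def)
  moreover have "mult_dens B \<le> mult_dens Z"
  proof (intro mult_dens_mono B)
    have "B \<subseteq> Z" using B assms(2) by (auto simp: Z_def X_def intro: multiplesI)
    thus "B \<subseteq> multiples Z" using subset_multiples by blast
  qed (simp add: Z_def)
  moreover have "mult_dens A \<le> mult_dens (insert c A)"
    using assms(1) c(1) by (intro mult_dens_subset) auto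
  moreover have "X \<union> A = insert c A" using assms(2) by (auto simp: X_def)
  ultimately show ?thesis by simp
qed

lemma mult_dens_saturation:
  assumes "B \<subseteq> {1..}"
  shows "mult_dens (saturation B) = mult_dens B"
proof (rule antisym)
  show "mult_dens (saturation B) \<le> mult_dens B"
  proof (rule mult_dens_leI)
    fix F assume F: "finite F" "F \<subseteq> saturation B"
    hence "mult_dens (B \<union> F) = mult_dens B"
    proof (induction F rule: finite_induct)
      case (insert c F)
      have "mult_dens (insert c (B \<union> F)) = mult_dens (B \<union> F)"
        using insert.prems assms saturation_subset[of B] by (intro mult_dens_insert_null[of _ B]) auto
      thus ?case using insert by simp
    qed simp
    moreover have "dens (multiples F) \<le> mult_dens (B \<union> F)"
      using F assms saturation_subset[of B] by (intro dens_multiples_le) auto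
    ultimately show "dens (multiples F) \<le> mult_dens B" by simp
  qed
  show "mult_dens B \<le> mult_dens (saturation B)"
    by (rule mult_dens_subset[OF saturation_subset subset_saturation[OF assms]])
qed

lemma mult_dens_primitive_core:
  assumes "A \<subseteq> {1..}"
  shows "mult_dens (primitive_core A) = mult_dens A"
proof -
  have "primitive_core A \<subseteq> {1..}" using assms by (auto simp: primitive_core_def)
  thus ?thesis using assms multiples_primitive_core[OF assms]
    by (intro antisym mult_dens_mono) (auto simp flip: multiples_subset_iff)
qed

text \<open>
  Suppose that \<open>b\<close> is redundant in the minimal elements \<open>P\<close> of the saturation. Then for some
  divisor \<open>g\<close> of \<open>b\<close> the elements \<open>a\<close> of \<open>P\<close> other than \<open>b\<close> with \<open>gcd a b = g\<close> cover almost all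
  multiples of \<open>g\<close>. Minimality of those \<open>a\<close> excludes \<open>g = b\<close>, and \<open>g\<close> belongs to the
  saturation, so that \<open>b\<close> is not minimal.
\<close>

theorem taut_primitive_core_saturation:
  assumes "B \<subseteq> {1..}"
  shows "taut (primitive_core (saturation B))"
proof -
  define S where "S = saturation B"
  define P where "P = primitive_core S"
  have S: "S \<subseteq> {1..}" "B \<subseteq> S" using saturation_subset subset_saturation[OF assms] by (auto simp: S_def)
  have PS: "P \<subseteq> S" by (auto simp: P_def primitive_core_def)
  have P: "P \<subseteq> {1..}" using PS S by auto
  have DP: "mult_dens P = mult_dens B"
    unfolding P_def mult_dens_primitive_core[OF S(1)] unfolding S_def by (rule mult_dens_saturation[OF assms])
  have "mult_dens (P - {b}) < mult_dens P" if b: "b \<in> P" for b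
  proof (rule ccontr)
    assume "\<not> ?thesis"
    hence eq: "mult_dens (insert b (P - {b})) = mult_dens (P - {b})"
      using mult_dens_subset[OF P, of "P - {b}"] b by (simp add: insert_absorb)
    have b1: "1 \<le> b" using b P by auto
    from P have "P - {b} \<subseteq> {1..}" by auto
    from scaled_Behrend_part[OF this b1 eq] obtain g where g: "g dvd b"
      "mult_dens {a \<in> P - {b}. gcd a b = g} = 1 / real g" .
    define G where "G = {a \<in> P - {b}. gcd a b = g}"
    have g1: "1 \<le> g" using g(1) b1 by (auto simp: Suc_le_eq intro!: Nat.gr0I)
    have "G \<noteq> {}" using g(2) g1 unfolding G_def[symmetric] by (intro notI) simp
    then obtain a where a: "a \<in> P" "a \<noteq> b" "gcd a b = g" by (auto simp: G_def)
    have "g \<noteq> b"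
    proof
      assume "g = b"
      hence "b dvd a" using a(3) by (metis gcd_dvd1)
      thus False using a b PS by (auto simp: P_def primitive_core_def)
    qed
    have "g \<in> saturation B"
    proof -
      have G: "G \<subseteq> {1..}" "G \<subseteq> P" using P by (auto simp: G_def)
      have dg: "multiples G = multiples {g} \<inter> multiples G" by (auto simp: G_def multiples_def intro: dvd_trans)
      have "mult_dens ({g} \<union> G) + mult_dens G = mult_dens {g} + mult_dens G"
        using g1 G by (intro mult_dens_modular[OF _ _ _ dg]) auto
      hence "g \<in> saturation G" using g(2) g1 mult_dens_singleton[OF g1] by (simp add: saturation_def G_def)
      hence "mult_dens (insert g P) = mult_dens P" by (rule mult_dens_insert_null[OF P G(2)])
      moreover have "mult_dens (insert g B) \<le> mult_dens (insert g P)"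
      proof (rule mult_dens_mono)
        have "B \<subseteq> multiples P" unfolding P_def multiples_primitive_core[OF S(1)]
          using S(2) subset_multiples by blast
        thus "insert g B \<subseteq> multiples (insert g P)" by (auto simp: multiples_def)
      qed (use assms g1 P in auto)
      moreover have "mult_dens B \<le> mult_dens (insert g B)" using assms g1 by (intro mult_dens_subset) auto
      ultimately show ?thesis using DP g1 by (simp add: saturation_def)
    qed
    thus False using g(1) \<open>g \<noteq> b\<close> b by (auto simp: P_def primitive_core_def S_def)
  qed
  thus ?thesis unfolding taut_iff[OF P, unfolded P_def S_def] by (simp add: P_def S_def)
qed

lemma taut_primitive:
  assumes "C \<subseteq> {1..}" "taut C"
  shows "primitive_core C = C"
proof -
  have "a = b" if ab: "a \<in> C" "b \<in> C" "a dvd b" for a b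
  proof (rule ccontr)
    assume "a \<noteq> b"
    hence "b \<in> multiples (C - {b})" using ab by (intro multiplesI[of a]) auto
    hence "C \<subseteq> multiples (C - {b})" using subset_multiples[of "C - {b}"] by auto
    hence "mult_dens C \<le> mult_dens (C - {b})" using assms(1) by (intro mult_dens_mono) auto
    thus False using assms ab(2) by (auto simp: taut_iff)
  qed
  thus ?thesis by (auto simp: primitive_core_def)
qed

text \<open>
  A taut set generates all multiples of its saturation. Otherwise a scaled Behrend set \<open>G = g A\<close>
  with \<open>1 \<notin> A\<close> would be contained in \<open>C\<close>. A Behrend set stays Behrend when an element
  \<open>q > 1\<close> is removed, because \<open>0 \<ge> (1 - \<delta>) (1 - 1 / q)\<close> for the density \<open>\<delta>\<close> of what remains.
  Hence every element of \<open>G\<close> would be redundant in \<open>C\<close>.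
\<close>

lemma saturation_taut:
  assumes "C \<subseteq> {1..}" "taut C"
  shows "saturation C \<subseteq> multiples C"
proof
  fix c assume "c \<in> saturation C"
  hence c: "1 \<le> c" "mult_dens (insert c C) = mult_dens C" by (auto simp: saturation_def)
  from scaled_Behrend_part[OF assms(1) c] obtain g
    where g: "g dvd c" "mult_dens {a \<in> C. gcd a c = g} = 1 / real g" .
  define G where "G = {a \<in> C. gcd a c = g}"
  have G: "G \<subseteq> {1..}" using assms by (auto simp: G_def)
  have g1: "1 \<le> g" using g(1) c(1) by (auto simp: Suc_le_eq intro!: Nat.gr0I)
  show "c \<in> multiples C"
  proof (cases "g \<in> C")
    case True thus ?thesis using g(1) by (auto simp: multiples_def)
  next
    case False
    have "G \<noteq> {}" using g(2) g1 unfolding G_def[symmetric] by (intro notI) simp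
    then obtain a where a: "a \<in> G" by auto
    hence aC: "a \<in> C" by (auto simp: G_def)
    define q where "q x = x div g" for x
    have q: "x = g * q x" "1 \<le> q x" if "x \<in> G" for x
    proof -
      have "g dvd x" using that by (auto simp: G_def)
      thus eq: "x = g * q x" by (simp add: q_def)
      have "0 < x" using that G by (auto simp: Suc_le_eq)
      thus "1 \<le> q x" by (subst (asm) eq) (auto simp: Suc_le_eq)
    qed
    have scale: "(*) g ` q ` H = H" "q ` H \<subseteq> {1..}" if "H \<subseteq> G" for H
      using q that unfolding image_image by (force, auto)
    have D: "mult_dens H = mult_dens (q ` H) / real g" if "H \<subseteq> G" for H
      using mult_dens_scale[OF g1 scale(2)[OF that]] scale(1)[OF that] by simp
    have "q a \<noteq> 1" using q(1)[OF a] False aC by (metis mult.right_neutral)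
    hence qa: "1 < q a" using q(2)[OF a] by linarith
    have "(1 - mult_dens (q ` (G - {a}))) * (1 - mult_dens {q a}) \<le> 1 - mult_dens (q ` (G - {a}) \<union> {q a})"
      using scale(2)[of "G - {a}"] q(2)[OF a] by (intro behrend_inequality) auto
    also have "q ` (G - {a}) \<union> {q a} = q ` G" using a by auto
    also have "mult_dens (q ` G) = 1" using D[of G] g(2) g1 by (simp add: G_def)
    finally have "mult_dens (q ` (G - {a})) = 1"
      using qa mult_dens_bounds[OF scale(2)[of "G - {a}"]] mult_dens_singleton[of "q a"]
      by (auto simp: mult_le_0_iff)
    hence D1: "mult_dens (G - {a}) = 1 / real g" using D[of "G - {a}"] by auto
    have "a \<in> saturation (G - {a})"
    proof -
      have "mult_dens (insert a (G - {a})) = mult_dens (G - {a})"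
        using D1 g(2) a by (simp add: insert_absorb G_def)
      thus ?thesis using a G by (auto simp: saturation_def)
    qed
    hence "mult_dens (insert a (C - {a})) = mult_dens (C - {a})"
      using assms(1) by (intro mult_dens_insert_null) (auto simp: G_def)
    hence "mult_dens C = mult_dens (C - {a})" using aC by (simp add: insert_absorb)
    moreover have "mult_dens (C - {a}) < mult_dens C" using assms aC by (simp add: taut_iff)
    ultimately show ?thesis by simp
  qed
qed

lemma primitive_core_cong:
  assumes "A \<subseteq> {1..}" "B \<subseteq> {1..}" "multiples A = multiples B"
  shows "primitive_core A \<subseteq> primitive_core B"
proof
  fix b assume b: "b \<in> primitive_core A"
  hence bA: "b \<in> A" and min: "\<And>a. a \<in> A \<Longrightarrow> a dvd b \<Longrightarrow> a = b" by (auto simp: primitive_core_def)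
  have below: "c = b" if c: "c \<in> B" "c dvd b" for c
  proof -
    have "c \<in> multiples A" using c subset_multiples[of B] assms(3) by auto
    then obtain a where a: "a \<in> A" "a dvd c" by (auto simp: multiples_def)
    hence "a = b" using min c(2) dvd_trans by blast
    thus ?thesis using a(2) c(2) by (simp add: dvd_antisym)
  qed
  moreover have "b \<in> multiples B" using bA subset_multiples[of A] assms(3) by auto
  then obtain c where "c \<in> B" "c dvd b" by (auto simp: multiples_def)
  ultimately show "b \<in> primitive_core B" by (auto simp: primitive_core_def)
qed

text \<open>
  Equality of densities puts \<open>C\<close> into the saturation of \<open>B\<close>, and makes the saturation of \<open>B\<close> part
  of that of \<open>C\<close>, which lies in \<open>multiples C\<close>. So \<open>C\<close> and the saturation of \<open>B\<close> have the same
  multiples; both have the same minimal elements, and a taut set consists of minimal elements.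
\<close>

theorem taut_unique:
  assumes "B \<subseteq> {1..}" "C \<subseteq> {1..}" "taut C" "B \<subseteq> multiples C" "mult_dens C = mult_dens B"
  shows "C = primitive_core (saturation B)"
proof -
  have "C \<subseteq> saturation B"
  proof
    fix c assume c: "c \<in> C"
    have "mult_dens (insert c B) \<le> mult_dens C"
      using assms c subset_multiples[of C] by (intro mult_dens_mono) auto
    moreover have "mult_dens B \<le> mult_dens (insert c B)"
      using assms c by (intro mult_dens_subset) auto
    ultimately show "c \<in> saturation B" using assms c by (auto simp: saturation_def)
  qed
  moreover have "saturation B \<subseteq> saturation C"
  proof
    fix c assume c: "c \<in> saturation B"
    hence c1: "1 \<le> c" by (simp add: saturation_def)
    have "mult_dens (insert c C) \<le> mult_dens (saturation B)"
      using c \<open>C \<subseteq> saturation B\<close> by (intro mult_dens_subset saturation_subset) auto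
    moreover have "mult_dens C \<le> mult_dens (insert c C)" using assms c1 by (intro mult_dens_subset) auto
    ultimately show "c \<in> saturation C"
      using assms mult_dens_saturation[OF assms(1)] c1 by (simp add: saturation_def)
  qed
  hence "saturation B \<subseteq> multiples C" using saturation_taut[OF assms(2,3)] by blast
  ultimately have "multiples C = multiples (saturation B)"
    using multiples_mono multiples_subset_iff by blast
  hence "primitive_core C = primitive_core (saturation B)"
    using primitive_core_cong assms(2) saturation_subset by blast
  thus ?thesis using taut_primitive[OF assms(2,3)] by simp
qed

section \<open>Windows and the metric\<close>

definition agree_on :: "nat \<Rightarrow> (int \<Rightarrow> bool) \<Rightarrow> (int \<Rightarrow> bool) \<Rightarrow> bool" where
  "agree_on k x y \<longleftrightarrow> (\<forall>i. \<bar>i\<bar> \<le> int k \<longrightarrow> x i = y i)"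

definition le_on :: "nat \<Rightarrow> (int \<Rightarrow> bool) \<Rightarrow> (int \<Rightarrow> bool) \<Rightarrow> bool" where
  "le_on k x y \<longleftrightarrow> (\<forall>i. \<bar>i\<bar> \<le> int k \<longrightarrow> x i \<longrightarrow> y i)"

lemma le_on_mono: "k \<le> l \<Longrightarrow> le_on l x y \<Longrightarrow> le_on k x y"
  by (simp add: le_on_def)

lemma agree_on_le_on: "agree_on k x y \<Longrightarrow> le_on k y z \<Longrightarrow> le_on k x z"
  by (simp add: agree_on_def le_on_def)

lemma agree_on_refl [simp]: "agree_on k x x"
  by (simp add: agree_on_def)

lemma open_cylinder: "open {y. agree_on k x y}"
proof -
  have "open {y. \<forall>i\<in>{- int k..int k}. y (id i) \<in> {x i}}"
    by (intro product_topology_basis') (auto simp: open_discrete)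
  moreover have "{y. agree_on k x y} = {y. \<forall>i\<in>{- int k..int k}. y (id i) \<in> {x i}}"
    by (auto simp: agree_on_def abs_le_iff)
  ultimately show ?thesis by simp
qed

lemma cylinder_neighbourhood:
  fixes U :: "(int \<Rightarrow> bool) set"
  assumes "open U" "x \<in> U"
  obtains k where "{y. agree_on k x y} \<subseteq> U"
proof -
  have "openin (product_topology (\<lambda>i. euclidean) UNIV) U"
    using assms(1) by (simp add: euclidean_product_topology)
  from product_topology_open_contains_basis[OF this assms(2)]
  obtain X where X: "x \<in> (\<Pi>\<^sub>E i\<in>UNIV. X i)" "finite {i. X i \<noteq> (UNIV :: bool set)}" "(\<Pi>\<^sub>E i\<in>UNIV. X i) \<subseteq> U"
    by auto
  define k where "k = (\<Sum>i | X i \<noteq> UNIV. nat \<bar>i\<bar>)"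
  have k: "\<bar>i\<bar> \<le> int k" if "X i \<noteq> UNIV" for i
  proof -
    have "nat \<bar>i\<bar> \<le> k" unfolding k_def using that X(2) by (intro member_le_sum) auto
    thus ?thesis by linarith
  qed
  have "y i \<in> X i" if "agree_on k x y" for y i
  proof (cases "X i = UNIV")
    case False
    hence "x i = y i" using k that by (simp add: agree_on_def)
    thus ?thesis using PiE_mem[OF X(1), of i] by simp
  qed simp
  hence "{y. agree_on k x y} \<subseteq> U" using X(3) by (auto simp: PiE_iff)
  thus thesis using that by blast
qed

lemma compact_sequence_space: "compact (UNIV :: (int \<Rightarrow> bool) set)"
proof -
  have "compact_space (product_topology (\<lambda>i::int. euclidean :: bool topology) UNIV)"
    unfolding compact_space_product_topology by (simp add: compact_space_def finite_imp_compact)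
  thus ?thesis unfolding euclidean_product_topology by (simp add: compact_space_def)
qed

lemma compatible_metricD:
  assumes "compatible_metric d"
  shows "Metric_space UNIV d" "openin (Metric_space.mtopology UNIV d) U \<longleftrightarrow> open U"
    "0 \<le> d x y" "d x x = 0" "d x y = d y x" "d x z \<le> d x y + d y z"
proof -
  show M: "Metric_space UNIV d" using assms by (simp add: compatible_metric_def)
  show "openin (Metric_space.mtopology UNIV d) U \<longleftrightarrow> open U"
    using assms by (simp add: compatible_metric_def)
  show "0 \<le> d x y" "d x x = 0" "d x y = d y x" "d x z \<le> d x y + d y z"
    using M by (auto simp: Metric_space_def)
qed

text \<open>
  Windows control the metric uniformly: by compactness finitely many cylinders, each inside a ball
  of radius \<open>e / 2\<close>, cover the space.
\<close>

lemma cylinders_small: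
  assumes "compatible_metric d" "0 < e"
  obtains k where "\<And>x y. agree_on k x y \<Longrightarrow> d x y < e"
proof -
  interpret Metric_space UNIV d by (rule compatible_metricD(1)[OF assms(1)])
  have "\<exists>k. {y. agree_on k x y} \<subseteq> mball x (e / 2)" for x
  proof -
    have "open (mball x (e / 2))" using compatible_metricD(2)[OF assms(1)] by blast
    thus ?thesis using cylinder_neighbourhood[of "mball x (e / 2)" x] assms(2) by auto
  qed
  then obtain k where k: "\<And>x. {y. agree_on (k x) x y} \<subseteq> mball x (e / 2)" by metis
  have cover: "UNIV \<subseteq> (\<Union>x\<in>UNIV. {y. agree_on (k x) x y})" by (auto intro: agree_on_refl)
  obtain T where T: "finite T" "UNIV \<subseteq> (\<Union>x\<in>T. {y. agree_on (k x) x y})"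
    by (rule compactE_image[OF compact_sequence_space _ cover]) (auto intro: open_cylinder)
  define K where "K = (\<Sum>x\<in>T. k x)"
  have "d y z < e" if yz: "agree_on K y z" for y z
  proof -
    obtain x where x: "x \<in> T" "agree_on (k x) x y" using T(2) by auto
    have "k x \<le> K" unfolding K_def using x(1) T(1) by (intro member_le_sum) auto
    hence "agree_on (k x) x z" using x(2) yz unfolding agree_on_def
      by (metis of_nat_mono order_trans)
    hence "d x y < e / 2" "d x z < e / 2" using k[of x] x(2) by auto
    thus ?thesis using compatible_metricD(5,6)[OF assms(1)] by (smt (verit) field_sum_of_halves)
  qed
  thus thesis using that by blast
qed

text \<open>
  Conversely, a Lebesgue number argument: the space is covered by finitely many balls whose
  doubles lie inside cylinders of the given width.
\<close>

lemma close_imp_agree_on: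
  assumes "compatible_metric d"
  obtains e where "0 < e" "\<And>x y. d x y < e \<Longrightarrow> agree_on k x y"
proof -
  interpret Metric_space UNIV d by (rule compatible_metricD(1)[OF assms])
  have "\<exists>e>0. mball x (2 * e) \<subseteq> {y. agree_on k x y}" for x
  proof -
    have "openin mtopology {y. agree_on k x y}"
      using open_cylinder compatible_metricD(2)[OF assms] by blast
    then obtain r where "0 < r" "mball x r \<subseteq> {y. agree_on k x y}"
      unfolding openin_mtopology by (auto intro: agree_on_refl)
    thus ?thesis by (intro exI[of _ "r / 2"]) auto
  qed
  then obtain e where e: "\<And>x. 0 < e x" "\<And>x. mball x (2 * e x) \<subseteq> {y. agree_on k x y}" by metis
  have cover: "UNIV \<subseteq> (\<Union>x\<in>UNIV. mball x (e x))" using e(1) by (auto simp: compatible_metricD[OF assms])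
  have "open (mball x (e x))" for x using compatible_metricD(2)[OF assms] by blast
  then obtain T where T: "finite T" "UNIV \<subseteq> (\<Union>x\<in>T. mball x (e x))"
    using compactE_image[OF compact_sequence_space _ cover] by metis
  hence "T \<noteq> {}" by auto
  define E where "E = Min (e ` T)"
  have "0 < E" unfolding E_def using T(1) \<open>T \<noteq> {}\<close> e(1) by simp
  moreover have "agree_on k y z" if yz: "d y z < E" for y z
  proof -
    have "y \<in> (\<Union>x\<in>T. mball x (e x))" using T(2) by blast
    then obtain x where x: "x \<in> T" "d x y < e x" by auto
    have "E \<le> e x" unfolding E_def using x(1) T(1) by simp
    hence "d x y < 2 * e x" "d x z < 2 * e x" using x(2) yz compatible_metricD(6)[OF assms, of x z y]
        compatible_metricD(3)[OF assms, of x y] by linarith+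
    hence "agree_on k x y" "agree_on k x z" using e(2)[of x] by auto
    thus ?thesis by (simp add: agree_on_def)
  qed
  ultimately show thesis using that by blast
qed

lemma hereditary_closureI:
  assumes "\<And>i. x i \<Longrightarrow> shift_pow m z i"
  shows "x \<in> hereditary_closure z"
proof -
  have "x \<in> X" if "hereditary X" "orbit_closure z \<subseteq> X" for X
  proof -
    have "shift_pow m z \<in> orbit_closure z"
      unfolding orbit_closure_def by (rule subsetD[OF closure_subset]) auto
    moreover have "x \<le> shift_pow m z" using assms by (simp add: le_fun_def)
    ultimately show ?thesis using that unfolding hereditary_def by blast
  qed
  thus ?thesis by (auto simp: hereditary_closure_def)
qed

text \<open>
  The sequences all of whose windows lie below a window of \<open>z\<close> form a hereditary subshift that
  contains the orbit closure of \<open>z\<close>.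
\<close>

lemma hereditary_closure_le_on:
  assumes "x \<in> hereditary_closure z"
  obtains m where "le_on k x (shift_pow m z)"
proof -
  define W where "W = {x. \<forall>k. \<exists>m. le_on k x (shift_pow m z)}"
  have "open (- {x. \<exists>m. le_on k x (shift_pow m z)})" for k
  proof (subst open_subopen, intro ballI)
    fix x assume "x \<in> - {x. \<exists>m. le_on k x (shift_pow m z)}"
    hence "{y. agree_on k x y} \<subseteq> - {x. \<exists>m. le_on k x (shift_pow m z)}"
      using agree_on_le_on by blast
    thus "\<exists>T. open T \<and> x \<in> T \<and> T \<subseteq> - {x. \<exists>m. le_on k x (shift_pow m z)}"
      by (intro exI[of _ "{y. agree_on k x y}"]) (simp add: open_cylinder)
  qed
  hence "closed {x. \<exists>m. le_on k x (shift_pow m z)}" for k by (simp add: closed_def)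
  hence "closed (\<Inter>k. {x. \<exists>m. le_on k x (shift_pow m z)})" by blast
  moreover have "(\<Inter>k. {x. \<exists>m. le_on k x (shift_pow m z)}) = W" by (auto simp: W_def)
  ultimately have closed: "closed W" by simp
  have shift: "shift_pow j x \<in> W" if x: "x \<in> W" for j x
  proof -
    have "\<exists>m. le_on k (shift_pow j x) (shift_pow m z)" for k
    proof -
      obtain m where m: "le_on (k + nat \<bar>j\<bar>) x (shift_pow m z)" using x by (auto simp: W_def)
      have "le_on k (shift_pow j x) (shift_pow (m + j) z)"
        unfolding le_on_def
      proof (intro allI impI)
        fix i assume "\<bar>i\<bar> \<le> int k" "shift_pow j x i"
        hence "z (i + j + m)" using m by (auto simp: le_on_def shift_pow_def)
        thus "shift_pow (m + j) z i" by (simp add: shift_pow_def add_ac)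
      qed
      thus ?thesis ..
    qed
    thus ?thesis by (simp add: W_def)
  qed
  have "left_shift ` W = W"
  proof
    have "left_shift x = shift_pow 1 x" for x by (simp add: left_shift_def shift_pow_def)
    thus "left_shift ` W \<subseteq> W" using shift by auto
    have "x = left_shift (shift_pow (- 1) x)" for x by (simp add: left_shift_def shift_pow_def)
    thus "W \<subseteq> left_shift ` W" using shift by blast
  qed
  with closed have "subshift W" by (simp add: subshift_def)
  moreover have "hereditary W"
    unfolding hereditary_def W_def le_on_def by (fastforce simp: le_fun_def)
  moreover have "orbit_closure z \<subseteq> W"
    unfolding orbit_closure_def
    by (rule closure_minimal[OF _ closed]) (auto simp: W_def le_on_def)
  ultimately have "x \<in> W" using assms by (auto simp: hereditary_closure_def)
  thus thesis using that by (auto simp: W_def)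
qed

section \<open>Sets of density zero\<close>

lemma has_density_0_iff:
  "has_density E 0 \<longleftrightarrow>
    (\<forall>e>0. \<forall>\<^sub>F N in sequentially. real (card (E \<inter> {1..int N})) \<le> e * real N)"
proof
  assume E: "has_density E 0"
  show "\<forall>e>0. \<forall>\<^sub>F N in sequentially. real (card (E \<inter> {1..int N})) \<le> e * real N"
  proof (intro allI impI)
    fix e :: real assume "0 < e"
    have "\<forall>\<^sub>F N in sequentially. real (card (E \<inter> {1..int N})) / real N < e"
      using E[unfolded has_density_def] \<open>0 < e\<close> by (rule order_tendstoD(2))
    thus "\<forall>\<^sub>F N in sequentially. real (card (E \<inter> {1..int N})) \<le> e * real N"
      using eventually_gt_at_top[of 0] by eventually_elim (auto simp: field_simps)
  qed
next
  assume *: "\<forall>e>0. \<forall>\<^sub>F N in sequentially. real (card (E \<inter> {1..int N})) \<le> e * real N"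
  show "has_density E 0"
    unfolding has_density_def
  proof (rule order_tendstoI)
    fix e :: real assume "0 < e"
    hence "\<forall>\<^sub>F N in sequentially. real (card (E \<inter> {1..int N})) \<le> e / 2 * real N"
      by (intro *[rule_format]) simp
    thus "\<forall>\<^sub>F N in sequentially. real (card (E \<inter> {1..int N})) / real N < e"
      using eventually_gt_at_top[of 0]
    proof eventually_elim
      case (elim N)
      have "real (card (E \<inter> {1..int N})) < e * real N" using elim \<open>0 < e\<close>
        by (intro le_less_trans[OF elim(1)]) (simp add: field_simps)
      thus ?case using elim by (simp add: field_simps)
    qed
  next
    fix e :: real assume "e < 0"
    thus "\<forall>\<^sub>F N in sequentially. e < real (card (E \<inter> {1..int N})) / real N"
      by (intro always_eventually allI less_le_trans[OF _ divide_nonneg_nonneg]) auto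
  qed
qed

text \<open>
  An element \<open>n\<close> of \<open>Bad k\<close> is admitted to \<open>E\<close> only if \<open>Bad k\<close> has proportion at most
  \<open>1 / (k + 1)\<close> in every \<open>{1..N}\<close> with \<open>N \<ge> n\<close>. For given \<open>N\<close>, the part of \<open>E\<close> up to \<open>N\<close> is
  then contained in the single set \<open>Bad K\<close> for the largest index \<open>K\<close> that is involved.
\<close>

lemma density_zero_diagonal:
  fixes Bad :: "nat \<Rightarrow> int set"
  assumes "\<And>k. has_density (Bad k) 0" "\<And>k l. k \<le> l \<Longrightarrow> Bad k \<subseteq> Bad l"
  shows "\<exists>E. has_density E 0 \<and> (\<forall>k. \<forall>\<^sub>F n in at_top. n \<in> Bad k \<longrightarrow> n \<in> E)"
proof (intro exI conjI allI)
  define ok where "ok k N \<longleftrightarrow> real (card (Bad k \<inter> {1..int N})) \<le> 1 / real (Suc k) * real N" for k N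
  define E where "E = {n. 1 \<le> n \<and> (\<exists>k. n \<in> Bad k \<and> (\<forall>N. n \<le> int N \<longrightarrow> ok k N))}"
  have ev: "\<exists>N0. \<forall>N\<ge>N0. ok k N" for k
  proof -
    have "\<forall>\<^sub>F N in sequentially. ok k N" unfolding ok_def
      using assms(1)[of k, unfolded has_density_0_iff, rule_format, of "1 / real (Suc k)"] by simp
    thus ?thesis by (simp add: eventually_sequentially)
  qed
  show "has_density E 0"
    unfolding has_density_0_iff
  proof (intro allI impI)
    fix e :: real assume "0 < e"
    then obtain j where j: "1 / real (Suc j) < e" using nat_approx_posE by blast
    obtain N0 where N0: "\<And>N. N0 \<le> N \<Longrightarrow> ok j N" using ev[of j] by blast
    have "real (card (E \<inter> {1..int N})) \<le> e * real N" if N: "N0 \<le> N" for N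
    proof -
      have "\<forall>n\<in>E \<inter> {1..int N}. \<exists>k. n \<in> Bad k \<and> ok k N" by (auto simp: E_def)
      then obtain k where k: "\<And>n. n \<in> E \<inter> {1..int N} \<Longrightarrow> n \<in> Bad (k n) \<and> ok (k n) N" by metis
      define S where "S = insert j (k ` (E \<inter> {1..int N}))"
      have S: "finite S" "S \<noteq> {}" by (auto simp: S_def)
      define K where "K = Max S"
      have "K \<in> S" unfolding K_def using S by (rule Max_in)
      hence "ok K N" using k N0[OF N] by (auto simp: S_def)
      have "j \<le> K" unfolding K_def using S by (intro Max_ge) (auto simp: S_def)
      have "n \<in> Bad K" if "n \<in> E \<inter> {1..int N}" for n
      proof -
        have "k n \<le> K" unfolding K_def using S that by (intro Max_ge) (auto simp: S_def)
        thus ?thesis using k[OF that] assms(2) by blast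
      qed
      hence "card (E \<inter> {1..int N}) \<le> card (Bad K \<inter> {1..int N})" by (intro card_mono) auto
      hence "real (card (E \<inter> {1..int N})) \<le> 1 / real (Suc K) * real N"
        using \<open>ok K N\<close> unfolding ok_def by linarith
      also have "\<dots> \<le> 1 / real (Suc j) * real N"
        using \<open>j \<le> K\<close> by (intro mult_right_mono frac_le) auto
      also have "\<dots> \<le> e * real N" using j by (intro mult_right_mono) auto
      finally show ?thesis .
    qed
    thus "\<forall>\<^sub>F N in sequentially. real (card (E \<inter> {1..int N})) \<le> e * real N"
      by (auto simp: eventually_sequentially)
  qed
  show "\<forall>\<^sub>F n in at_top. n \<in> Bad k \<longrightarrow> n \<in> E" for k
  proof -
    obtain N0 where N0: "\<And>N. N0 \<le> N \<Longrightarrow> ok k N" using ev[of k] by blast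
    have "n \<in> E" if "n \<in> Bad k" "max 1 (int N0) \<le> n" for n
      using that N0 unfolding E_def by (auto intro!: exI[of _ k])
    thus ?thesis unfolding eventually_at_top_linorder by blast
  qed
qed

section \<open>Attraction\<close>

text \<open>
  The windows of \<open>x\<close> lie below windows of \<open>eta B\<close> at positions \<open>m K\<close>. One residue of \<open>m K\<close>
  modulo the period of \<open>F\<close> occurs for arbitrarily large windows, and it serves for the whole of
  \<open>x\<close>. The translation \<open>r\<close> may be increased by multiples of the period; asking for \<open>k \<le> r\<close>
  keeps windows of radius \<open>k\<close> around positive integers within the natural numbers.
\<close>

lemma support_avoids_shifted_multiples:
  assumes "x \<in> hereditary_closure (eta B)" "finite F" "F \<subseteq> B" "F \<subseteq> {1..}"
  obtains r :: nat where "k \<le> r" "\<And>i. x i \<Longrightarrow> i + int r \<notin> multiples_of F"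
proof -
  define Q where "Q = \<Prod>F"
  have Q: "0 < Q" using assms unfolding Q_def by (intro prod_pos) (auto simp: Suc_le_eq)
  have "\<exists>m. le_on K x (shift_pow m (eta B))" for K
    using hereditary_closure_le_on[OF assms(1)] by metis
  then obtain m where m: "\<And>K. le_on K x (shift_pow (m K) (eta B))" by metis
  have "finite (range (\<lambda>K. m K mod int Q))"
    by (rule finite_subset[of _ "{0..<int Q}"]) (use Q in auto)
  then obtain K0 where K0: "infinite {K \<in> UNIV. m K mod int Q = m K0 mod int Q}"
    using pigeonhole_infinite[of UNIV "\<lambda>K. m K mod int Q"] by auto
  define r where "r = nat (m K0 mod int Q) + k * Q"
  have "k \<le> r" using Q by (simp add: r_def trans_le_add2)
  moreover have "i + int r \<notin> multiples_of F" if "x i" for i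
  proof
    assume "i + int r \<in> multiples_of F"
    then obtain a where a: "a \<in> F" "int a dvd i + int r" by (auto simp: in_multiples_of)
    obtain K where K: "nat \<bar>i\<bar> \<le> K" "m K mod int Q = m K0 mod int Q"
      using K0 unfolding infinite_nat_iff_unbounded_le by auto
    have "\<bar>i\<bar> \<le> int K" using K(1) by linarith
    hence "i + m K \<notin> multiples_of B"
      using m[of K] that by (auto simp: le_on_def shift_pow_def eta_def free_of_def)
    moreover have "int a dvd int Q" using a(1) assms(2) unfolding Q_def by (simp add: dvd_prodI)
    moreover have "int Q dvd m K - int r"
    proof -
      have "int r = m K mod int Q + int k * int Q" using Q K(2) by (simp add: r_def)
      thus ?thesis by (simp add: mod_eq_dvd_iff[symmetric])
    qed
    ultimately have "int a dvd (i + int r) + (m K - int r)" using a(2) by (meson dvd_add dvd_trans)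
    thus False using \<open>i + m K \<notin> _\<close> a(1) assms(3) by (auto simp: in_multiples_of)
  qed
  ultimately show thesis using that by blast
qed

text \<open>
  The factor \<open>L + 1\<close> arises twice: there are \<open>L + 1\<close> translates, and
  \<open>1 / m \<le> (L + 1) / (m + j)\<close> for \<open>j \<le> L\<close>.
\<close>

lemma log_sum_translates:
  assumes "\<And>m. m \<in> V \<Longrightarrow> 1 \<le> m \<Longrightarrow> \<exists>j\<le>L. m + j \<in> G"
  shows "log_sum V N \<le> real (Suc L) * real (Suc L) * log_sum G (N + L)"
proof -
  have "log_sum V N \<le> (\<Sum>m=1..N. \<Sum>j\<le>L. if m + j \<in> G then real (Suc L) / real (m + j) else 0)"
  proof -
    have "1 / real m \<le> (\<Sum>j\<le>L. if m + j \<in> G then real (Suc L) / real (m + j) else 0)"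
      if m: "m \<in> V \<inter> {1..N}" for m
    proof -
      obtain j where j: "j \<le> L" "m + j \<in> G" using assms m by auto
      have "m + j \<le> Suc L * m" using m j(1)
        by (cases m) (auto intro: order_trans[OF _ mult_le_mono2])
      hence "1 / real m \<le> real (Suc L) / real (m + j)"
        using m by (simp add: field_simps flip: of_nat_mult of_nat_add del: of_nat_Suc)
      also have "\<dots> = (if m + j \<in> G then real (Suc L) / real (m + j) else 0)" using j by simp
      also have "\<dots> \<le> (\<Sum>j\<le>L. if m + j \<in> G then real (Suc L) / real (m + j) else 0)"
        using j(1) by (intro member_le_sum) auto
      finally show ?thesis .
    qed
    hence "log_sum V N \<le> (\<Sum>m\<in>V \<inter> {1..N}. \<Sum>j\<le>L. if m + j \<in> G then real (Suc L) / real (m + j) else 0)"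
      unfolding log_sum_def by (rule sum_mono)
    also have "\<dots> \<le> (\<Sum>m=1..N. \<Sum>j\<le>L. if m + j \<in> G then real (Suc L) / real (m + j) else 0)"
      by (intro sum_mono2) (auto intro: sum_nonneg)
    finally show ?thesis .
  qed
  also have "\<dots> = (\<Sum>j\<le>L. \<Sum>m=1..N. if m + j \<in> G then real (Suc L) / real (m + j) else 0)"
    by (rule sum.swap)
  also have "\<dots> \<le> (\<Sum>j\<le>L. real (Suc L) * log_sum G (N + L))"
  proof (rule sum_mono)
    fix j assume j: "j \<in> {..L}"
    have "(\<Sum>m=1..N. if m + j \<in> G then real (Suc L) / real (m + j) else 0)
        = (\<Sum>n\<in>(\<lambda>m. m + j) ` {1..N}. if n \<in> G then real (Suc L) / real n else 0)"
      by (subst sum.reindex) (auto simp: inj_on_def)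
    also have "\<dots> \<le> (\<Sum>n\<in>{1..N + L}. if n \<in> G then real (Suc L) / real n else 0)"
      using j by (intro sum_mono2) auto
    also have "\<dots> = (\<Sum>n\<in>{1..N + L} \<inter> G. real (Suc L) / real n)"
      by (rule sum.inter_restrict[symmetric]) simp
    also have "\<dots> = real (Suc L) * log_sum G (N + L)"
      by (simp add: log_sum_def sum_distrib_left Int_commute)
    finally show "(\<Sum>m=1..N. if m + j \<in> G then real (Suc L) / real (m + j) else 0)
        \<le> real (Suc L) * log_sum G (N + L)" .
  qed
  also have "\<dots> = real (Suc L) * real (Suc L) * log_sum G (N + L)" by simp
  finally show ?thesis .
qed

lemma dens_translates_le:
  assumes "periodic Q V" "\<And>m. m \<in> V \<Longrightarrow> 1 \<le> m \<Longrightarrow> \<exists>j\<le>L. m + j \<in> G"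
    and "(\<lambda>N. log_sum G N / ln (real N)) \<longlonglongrightarrow> c"
  shows "dens V \<le> real (Suc L) * real (Suc L) * c"
proof (rule LIMSEQ_le[OF log_sum_periodic[OF assms(1)]])
  have "(\<lambda>N. log_sum G (N + L) / ln (real (N + L))) \<longlonglongrightarrow> c"
    using assms(3) by (rule LIMSEQ_ignore_initial_segment)
  moreover have "(\<lambda>N. ln (real (N + L)) / ln (real N)) \<longlonglongrightarrow> 1" by real_asymp
  ultimately show "(\<lambda>N. real (Suc L) * real (Suc L)
      * (log_sum G (N + L) / ln (real (N + L)) * (ln (real (N + L)) / ln (real N)))) \<longlonglongrightarrow>
      real (Suc L) * real (Suc L) * c"
    using tendsto_mult by (intro tendsto_mult_left) fastforce
  have "log_sum V N / ln (real N) \<le> real (Suc L) * real (Suc L)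
      * (log_sum G (N + L) / ln (real (N + L)) * (ln (real (N + L)) / ln (real N)))" if "2 \<le> N" for N
  proof -
    have "log_sum V N / ln (real N) \<le> real (Suc L) * real (Suc L) * log_sum G (N + L) / ln (real N)"
      using that by (intro divide_right_mono log_sum_translates[OF assms(2)]) auto
    also have "\<dots> = real (Suc L) * real (Suc L)
        * (log_sum G (N + L) / ln (real (N + L)) * (ln (real (N + L)) / ln (real N)))"
      using that by simp
    finally show ?thesis .
  qed
  thus "\<exists>N. \<forall>n\<ge>N. log_sum V n / ln (real n) \<le> real (Suc L) * real (Suc L)
      * (log_sum G (n + L) / ln (real (n + L)) * (ln (real (n + L)) / ln (real n)))" by blast
qed

text \<open>
  Choose a finite \<open>F \<subseteq> B\<close> whose multiples almost exhaust those of \<open>B\<close>, hence also those of \<open>C\<close>,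
  and \<open>r\<close> such that the support of \<open>x\<close>, translated by \<open>r\<close>, avoids the multiples of \<open>F\<close>. A
  window of \<open>x\<close> that lies below no window of \<open>eta C\<close> is then situated, after translation, at a
  place where the pattern of numbers free of \<open>F\<close> lies below no window of \<open>eta C\<close>. Let \<open>V\<close> be the
  set of the starting points of these windows. It is periodic, since it refers to the finite set
  \<open>F\<close> only. In particular the pattern does not lie below the window of \<open>eta C\<close> at the same
  place, so the window contains a multiple of \<open>C\<close> that is no multiple of \<open>F\<close>. Such numbers have
  small logarithmic density, and for the periodic set \<open>V\<close> a small logarithmic density is a small
  natural density. This step turns logarithmic information about \<open>C\<close> into natural
  density along \<open>x\<close>.
\<close>

theorem undominated_windows_density_zero:
  assumes "B \<subseteq> {1..}" "C \<subseteq> {1..}" "B \<subseteq> multiples C" "mult_dens C = mult_dens B"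
    and "x \<in> hereditary_closure (eta B)"
  shows "has_density {n. \<not> (\<exists>m. le_on k (shift_pow n x) (shift_pow m (eta C)))} 0" (is "has_density ?Bad 0")
  unfolding has_density_0_iff
proof (intro allI impI)
  fix e :: real assume e: "0 < e"
  \<comment> \<open>A window of radius \<open>k\<close> is described by its left end point and its length \<open>L + 1\<close>.\<close>
  define L where "L = 2 * k"
  define cL where "cL = real (Suc L) * real (Suc L)"
  have cL: "0 < cL" by (simp add: cL_def)
  obtain F where F: "finite F" "F \<subseteq> B" "mult_dens B - e / (2 * cL) < dens (multiples F)"
    using mult_dens_approx[OF assms(1), of "e / (2 * cL)"] e cL by auto
  have F1: "F \<subseteq> {1..}" using F assms(1) by auto
  obtain r where r: "k \<le> r" "\<And>i. x i \<Longrightarrow> i + int r \<notin> multiples_of F"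
    using support_avoids_shifted_multiples[OF assms(5) F(1,2) F1] by blast
  define V where "V = {m::nat. \<not> (\<exists>m'. \<forall>i. 0 \<le> i \<and> i \<le> int L \<longrightarrow>
      int m + i \<notin> multiples_of F \<longrightarrow> m' + i \<notin> multiples_of C)}"
  define Q where "Q = \<Prod>F"
  have Q: "0 < Q" using F(1) F1 unfolding Q_def by (intro prod_pos) (auto simp: Suc_le_eq)
  have "int (m + Q) + i \<in> multiples_of F \<longleftrightarrow> int m + i \<in> multiples_of F" for m i
  proof -
    have "int a dvd int (m + Q) + i \<longleftrightarrow> int a dvd int m + i" if "a \<in> F" for a
    proof -
      have "int a dvd int Q" using that F(1) unfolding Q_def by (simp add: dvd_prodI)
      moreover have "int (m + Q) + i = int Q + (int m + i)" by simp
      ultimately show ?thesis by (metis dvd_add_right_iff)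
    qed
    thus ?thesis by (auto simp: in_multiples_of)
  qed
  hence V: "periodic Q V" using Q unfolding periodic_def V_def by simp
  have FC: "multiples F \<subseteq> multiples C" using F(2) assms(3) by (auto simp: multiples_subset_iff)
  have "(\<lambda>N. log_sum (multiples C - multiples F) N / ln (real N)) \<longlonglongrightarrow> mult_dens C - dens (multiples F)"
    unfolding log_sum_Diff[OF FC] diff_divide_distrib
    by (intro tendsto_diff davenport_erdos assms log_sum_periodic[OF periodic_multiples] F(1) F1)
  moreover have "\<exists>j\<le>L. m + j \<in> multiples C - multiples F" if "m \<in> V" "1 \<le> m" for m
  proof -
    from that obtain i where i: "0 \<le> i" "i \<le> int L" "int m + i \<notin> multiples_of F" "int m + i \<in> multiples_of C"
      unfolding V_def by blast
    define j where "j = nat i"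
    have "int m + i = int (m + j)" using i by (simp add: j_def)
    hence "m + j \<in> multiples C - multiples F" using i(3,4) of_nat_in_multiples_of by (metis DiffI)
    moreover have "j \<le> L" using i by (simp add: j_def)
    ultimately show ?thesis by blast
  qed
  ultimately have "dens V \<le> cL * (mult_dens C - dens (multiples F))"
    unfolding cL_def by (intro dens_translates_le[OF V])
  also have "\<dots> < cL * (e / (2 * cL))" using F(3) assms(4) cL by (intro mult_strict_left_mono) auto
  finally have dV: "dens V < e / 2" using cL by simp
  have mem: "nat n + r - k \<in> V" if n: "1 \<le> n" "n \<in> ?Bad" for n
  proof (rule ccontr)
    assume "nat n + r - k \<notin> V"
    then obtain m' where m': "\<And>i. 0 \<le> i \<Longrightarrow> i \<le> int L \<Longrightarrow>
        int (nat n + r - k) + i \<notin> multiples_of F \<Longrightarrow> m' + i \<notin> multiples_of C"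
      unfolding V_def by blast
    have "le_on k (shift_pow n x) (shift_pow (m' + int k) (eta C))"
      unfolding le_on_def
    proof (intro allI impI)
      fix i assume i: "\<bar>i\<bar> \<le> int k" "shift_pow n x i"
      hence "i + n + int r \<notin> multiples_of F" using r(2) by (simp add: shift_pow_def)
      moreover have "int (nat n + r - k) + (i + int k) = i + n + int r" using n(1) r(1) by simp
      ultimately have "int (nat n + r - k) + (i + int k) \<notin> multiples_of F" by metis
      moreover have "0 \<le> i + int k" "i + int k \<le> int L" using i(1) by (auto simp: L_def)
      ultimately have "m' + (i + int k) \<notin> multiples_of C" using m' by blast
      thus "shift_pow (m' + int k) (eta C) i" by (simp add: shift_pow_def eta_def free_of_def add_ac)
    qed
    thus False using n(2) by blast
  qed
  have count: "real (card (?Bad \<inter> {1..int N})) \<le> dens V * real N + (real r + real Q)" for N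
  proof -
    have "card (?Bad \<inter> {1..int N}) \<le> count_upto V (N + r)"
      unfolding count_upto_def
    proof (rule card_inj_on_le[of "\<lambda>n. nat n + r - k"])
      show "inj_on (\<lambda>n. nat n + r - k) (?Bad \<inter> {1..int N})"
        using r(1) by (auto simp: inj_on_def)
      show "(\<lambda>n. nat n + r - k) ` (?Bad \<inter> {1..int N}) \<subseteq> V \<inter> {1..N + r}"
        using mem r(1) by auto
    qed auto
    hence "real (card (?Bad \<inter> {1..int N})) \<le> real (count_upto V (N + r))" by linarith
    also have "\<dots> \<le> dens V * real (N + r) + real Q" using count_upto_dens[OF V, of "N + r"] by linarith
    also have "\<dots> \<le> dens V * real N + (real r + real Q)"
      using mult_right_mono[OF dens_bounds(2)[OF V], of "real r"] by (simp add: distrib_left)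
    finally show ?thesis .
  qed
  have "\<forall>\<^sub>F N in sequentially. real r + real Q \<le> e / 2 * real N"
    using e by real_asymp
  thus "\<forall>\<^sub>F N in sequentially. real (card (?Bad \<inter> {1..int N})) \<le> e * real N"
  proof eventually_elim
    case (elim N)
    have "dens V * real N \<le> e / 2 * real N" using dV by (intro mult_right_mono) auto
    thus ?case using elim count[of N] by (simp add: field_simps)
  qed
qed

section \<open>Attraction forces equal density\<close>

lemma sum_shifted_indicator:
  "(\<Sum>n=1..N. of_bool (n + j \<in> X)) + count_upto X j = count_upto X (N + j)"
  by (induction N) (auto simp: count_upto_Suc)

lemma window_count_periodic:
  assumes "periodic Q Y"
  shows "(\<Sum>j=1..Q. of_bool (n + j \<in> Y)) = count_upto Y Q"
  using sum_shifted_indicator[where N = Q and j = n and X = Y] count_upto_add_period[OF assms, of n]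
  by (simp add: add.commute)

text \<open>
  Let \<open>F \<subseteq> C\<close> be finite with period \<open>Q\<close>. Every interval of \<open>Q\<close> consecutive integers contains
  exactly \<open>q = (1 - dens (multiples F)) Q\<close> numbers free of \<open>F\<close>, so a window of length \<open>Q\<close> below
  \<open>eta C\<close> has at most \<open>q\<close> ones. Attraction makes almost all windows of \<open>eta B\<close> of this kind,
  and counting the pairs of a window and a one in it bounds the upper density of the numbers free
  of \<open>B\<close> by \<open>q / Q\<close>. Partial summation carries the bound over to logarithmic density.
\<close>

theorem mult_dens_le_of_attraction:
  assumes "B \<subseteq> {1..}" "C \<subseteq> {1..}" and "has_density E 0"
    and attr: "\<And>k. \<forall>\<^sub>F n in at_top. n \<notin> E \<longrightarrow> (\<exists>m. le_on k (shift_pow n (eta B)) (shift_pow m (eta C)))"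
  shows "mult_dens C \<le> mult_dens B"
proof (rule mult_dens_leI)
  fix F assume F: "finite F" "F \<subseteq> C"
  have F1: "F \<subseteq> {1..}" using F assms by auto
  define Q where "Q = \<Prod>F"
  have per: "periodic Q (- multiples F)"
    unfolding Q_def by (rule gcd_determined_periodic[OF gcd_determined_multiples_of_finite(2)[OF F(1) F1]])
  have Q: "0 < Q" using per by (simp add: periodic_def)
  define q where "q = count_upto (- multiples F) Q"
  define \<alpha> where "\<alpha> = 1 - dens (multiples F)"
  have q: "real q = \<alpha> * real Q"
    using dens_periodic[OF per] dens_Compl[OF periodic_multiples[OF F(1) F1]] Q
    by (simp add: \<alpha>_def q_def field_simps)
  have dvd_shift: "int a dvd u + int Q * v \<longleftrightarrow> int a dvd u" if "a \<in> F" for a u v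
  proof -
    have "int a dvd int Q" using that F(1) unfolding Q_def by (simp add: dvd_prodI)
    thus ?thesis by (metis dvd_add_left_iff dvd_mult2)
  qed
  define X where "X = - multiples B"
  obtain n0 where n0: "\<And>n. n0 \<le> n \<Longrightarrow> n \<notin> E \<Longrightarrow> \<exists>m. le_on Q (shift_pow n (eta B)) (shift_pow m (eta C))"
    using attr[of Q] unfolding eventually_at_top_linorder by blast
  define W where "W n = (\<Sum>j=1..Q. of_bool (n + j \<in> X) :: nat)" for n
  have good: "W n \<le> q" if n: "n0 \<le> int n" "int n \<notin> E" for n
  proof -
    obtain m where m: "le_on Q (shift_pow (int n) (eta B)) (shift_pow m (eta C))" using n0 n by blast
    \<comment> \<open>A natural number congruent to \<open>m\<close> modulo the period.\<close>
    define p where "p = nat (m + int Q * \<bar>m\<bar>)"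
    have "0 \<le> m + int Q * \<bar>m\<bar>" using Q mult_right_mono[of 1 "int Q" "\<bar>m\<bar>"] by linarith
    hence p: "int p = m + int Q * \<bar>m\<bar>" by (simp add: p_def)
    have "p + j \<in> - multiples F" if j: "n + j \<in> X" "j \<in> {1..Q}" for j
    proof
      assume "p + j \<in> multiples F"
      then obtain a where a: "a \<in> F" "a dvd p + j" by (auto simp: multiples_def)
      hence "int a dvd (m + int j) + int Q * \<bar>m\<bar>" using p by (metis add.assoc add.commute int_dvd_int_iff of_nat_add)
      hence "int a dvd m + int j" using dvd_shift[OF a(1)] by simp
      moreover have "shift_pow (int n) (eta B) (int j)"
        using j(1) of_nat_in_multiples_of[of "n + j" B]
        by (simp add: X_def shift_pow_def eta_def free_of_def add.commute)
      hence "shift_pow m (eta C) (int j)" using m j(2) by (auto simp: le_on_def)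
      hence "m + int j \<notin> multiples_of C" by (simp add: shift_pow_def eta_def free_of_def add.commute)
      ultimately show False using a(1) F(2) by (auto simp: in_multiples_of)
    qed
    hence "W n \<le> (\<Sum>j=1..Q. of_bool (p + j \<in> - multiples F))"
      unfolding W_def by (intro sum_mono) auto
    also have "\<dots> = q" unfolding q_def by (rule window_count_periodic[OF per])
    finally show ?thesis .
  qed
  have "W n \<le> q + Q * of_bool (int n \<in> E \<or> int n < n0)" for n
  proof -
    have "W n \<le> (\<Sum>j=1..Q. 1)" unfolding W_def by (intro sum_mono) auto
    thus ?thesis using good[of n] by (cases "int n \<in> E \<or> int n < n0") auto
  qed
  have bound: "real (count_upto X N) \<le> \<alpha> * real N + (real (card (E \<inter> {1..int N})) + real (nat n0) + real Q)" for N
  proof -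
    let ?S = "{n \<in> {1..N}. int n \<in> E \<or> int n < n0}"
    have "Q * count_upto X N \<le> (\<Sum>j=1..Q. (\<Sum>n=1..N. of_bool (n + j \<in> X)) + Q)"
    proof -
      have "count_upto X N \<le> (\<Sum>n=1..N. of_bool (n + j \<in> X)) + Q" if "j \<in> {1..Q}" for j
      proof -
        have "count_upto X N \<le> count_upto X (N + j)" unfolding count_upto_def by (intro card_mono) auto
        thus ?thesis using sum_shifted_indicator[where N = N and j = j and X = X] count_upto_le[of X j] that by simp
      qed
      hence "(\<Sum>j=1..Q. count_upto X N) \<le> (\<Sum>j=1..Q. (\<Sum>n=1..N. of_bool (n + j \<in> X)) + Q)"
        by (rule sum_mono)
      thus ?thesis by simp
    qed
    also have "\<dots> = (\<Sum>n=1..N. W n) + Q * Q"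
      unfolding W_def sum.distrib by (subst sum.swap) simp
    also have "(\<Sum>n=1..N. W n) \<le> (\<Sum>n=1..N. q + Q * of_bool (int n \<in> E \<or> int n < n0))"
      using \<open>\<And>n. W n \<le> _\<close> by (rule sum_mono)
    also have "\<dots> = q * N + Q * (\<Sum>n=1..N. of_bool (int n \<in> E \<or> int n < n0))"
      by (simp add: sum.distrib sum_distrib_left)
    also have "(\<Sum>n=1..N. of_bool (int n \<in> E \<or> int n < n0)) = card ?S"
      by (simp only: card_eq_sum sum.inter_filter[OF finite_atLeastAtMost] of_bool_def)
    also have "card ?S \<le> card (E \<inter> {1..int N}) + nat n0"
    proof -
      have "int ` ?S \<subseteq> (E \<inter> {1..int N}) \<union> {0..<n0}" by auto
      hence "card (int ` ?S) \<le> card ((E \<inter> {1..int N}) \<union> {0..<n0})" by (intro card_mono) auto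
      also have "\<dots> \<le> card (E \<inter> {1..int N}) + card {0..<n0}" by (rule card_Un_le)
      finally show ?thesis by (simp add: card_image)
    qed
    finally have "Q * count_upto X N \<le> q * N + Q * (card (E \<inter> {1..int N}) + nat n0) + Q * Q"
      by simp
    hence "real (Q * count_upto X N) \<le> real (q * N + Q * (card (E \<inter> {1..int N}) + nat n0) + Q * Q)"
      by (rule of_nat_mono)
    hence "real Q * real (count_upto X N)
        \<le> real Q * (\<alpha> * real N + (real (card (E \<inter> {1..int N})) + real (nat n0) + real Q))"
      using q by (simp add: algebra_simps)
    thus ?thesis using Q by simp
  qed
  have "1 - mult_dens B \<le> \<alpha> + e" if e: "0 < e" for e
  proof -
    have "\<forall>\<^sub>F N in sequentially. real (card (E \<inter> {1..int N})) \<le> e * real N"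
      using assms(3) e by (simp add: has_density_0_iff)
    then obtain N0 where N0: "\<And>N. N0 \<le> N \<Longrightarrow> real (card (E \<inter> {1..int N})) \<le> e * real N"
      by (auto simp: eventually_sequentially)
    have cardE: "real (card (E \<inter> {1..int N})) \<le> e * real N + real N0" for N
    proof (cases "N0 \<le> N")
      case False
      have "card (E \<inter> {1..int N}) \<le> card {1..int N}" by (intro card_mono) auto
      moreover have "0 \<le> e * real N" using e by simp
      ultimately show ?thesis using False by simp
    qed (use N0 in force)
    define K where "K = real N0 + real (nat n0) + real Q"
    have "real (count_upto X N) \<le> (\<alpha> + e) * real N + K" for N
      using bound[of N] cardE[of N] by (simp add: K_def algebra_simps)
    hence up: "log_sum X N \<le> (\<alpha> + e) * harm N + K" for N
      by (intro log_sum_deviation) (auto simp: K_def)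
    have eq: "log_sum X N = harm N - log_sum (multiples B) N" for N
      using log_sum_disjoint[of "multiples B" X N] log_sum_UNIV[of N] by (simp add: X_def)
    show ?thesis
    proof (rule LIMSEQ_le)
      show "(\<lambda>N. harm N / ln (real N) - log_sum (multiples B) N / ln (real N)) \<longlonglongrightarrow> 1 - mult_dens B"
        by (intro tendsto_diff tendsto_harm_over_ln davenport_erdos assms)
      have "(\<lambda>N. K / ln (real N)) \<longlonglongrightarrow> 0" by real_asymp
      from tendsto_add[OF tendsto_mult_left[OF tendsto_harm_over_ln, of "\<alpha> + e"] this]
      show "(\<lambda>N. (\<alpha> + e) * (harm N / ln (real N)) + K / ln (real N)) \<longlonglongrightarrow> \<alpha> + e" by simp
      have "harm N / ln (real N) - log_sum (multiples B) N / ln (real N)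
          \<le> (\<alpha> + e) * (harm N / ln (real N)) + K / ln (real N)" if "2 \<le> N" for N
      proof -
        have "log_sum X N / ln (real N) \<le> ((\<alpha> + e) * harm N + K) / ln (real N)"
          using that by (intro divide_right_mono up) simp
        thus ?thesis unfolding eq by (simp add: diff_divide_distrib add_divide_distrib)
      qed
      thus "\<exists>M. \<forall>N\<ge>M. harm N / ln (real N) - log_sum (multiples B) N / ln (real N)
          \<le> (\<alpha> + e) * (harm N / ln (real N)) + K / ln (real N)" by blast
    qed
  qed
  hence "1 - mult_dens B \<le> \<alpha>" by (rule field_le_epsilon)
  thus "dens (multiples F) \<le> mult_dens B" by (simp add: \<alpha>_def)
qed

section \<open>The taut set attracting the hereditary closure\<close>

lemma free_of_subset_iff: "free_of C \<subseteq> free_of B \<longleftrightarrow> B \<subseteq> multiples C"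
proof
  assume sub: "free_of C \<subseteq> free_of B"
  show "B \<subseteq> multiples C"
  proof
    fix b assume "b \<in> B"
    hence "int b \<in> multiples_of B" unfolding of_nat_in_multiples_of by (rule multiplesI) simp
    hence "int b \<in> multiples_of C" using sub by (auto simp: free_of_def)
    thus "b \<in> multiples C" by (simp add: of_nat_in_multiples_of)
  qed
next
  assume sub: "B \<subseteq> multiples C"
  have "m \<in> multiples_of C" if m: "m \<in> multiples_of B" for m
  proof -
    obtain b where b: "b \<in> B" "int b dvd m" using m by (auto simp: in_multiples_of)
    then obtain c where c: "c \<in> C" "c dvd b" using sub by (auto simp: multiples_def)
    have "int c dvd m" using b(2) c(2) by (meson dvd_trans int_dvd_int_iff)
    thus ?thesis using c(1) by (auto simp: in_multiples_of)
  qed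
  thus "free_of C \<subseteq> free_of B" by (auto simp: free_of_def)
qed

theorem corollary1p6:
  fixes d :: "(int \<Rightarrow> bool) \<Rightarrow> (int \<Rightarrow> bool) \<Rightarrow> real"
    and B :: "nat set"
  assumes "compatible_metric d"
    and "B \<subseteq> {1..}"
  shows "\<exists>!B'. B' \<subseteq> {1..} \<and> taut B' \<and> free_of B' \<subseteq> free_of B \<and>
    (\<forall>x \<in> hereditary_closure (eta B). \<exists>E. has_density E 0 \<and>
      ((\<lambda>n. dist_to_set d (shift_pow n x) (hereditary_closure (eta B'))) \<longlongrightarrow> 0)
        (inf at_top (principal (- E))))"
proof (rule ex1I)
  note metric = compatible_metricD[OF assms(1)]
  have nonneg: "0 \<le> dist_to_set d x (hereditary_closure (eta C))" for x C
  proof -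
    have "eta C \<in> hereditary_closure (eta C)" by (rule hereditary_closureI[of _ 0]) (simp add: shift_pow_def)
    thus ?thesis unfolding dist_to_set_def by (intro cINF_greatest metric(3)) auto
  qed
  have le: "dist_to_set d x (hereditary_closure (eta C)) \<le> d x y"
    if "y \<in> hereditary_closure (eta C)" for x y C
    unfolding dist_to_set_def by (intro cINF_lower bdd_belowI[of _ 0]) (auto simp: metric that)
  define C where "C = primitive_core (saturation B)"
  have C1: "C \<subseteq> {1..}" unfolding C_def primitive_core_def using saturation_subset by auto
  have CB: "B \<subseteq> multiples C" unfolding C_def multiples_primitive_core[OF saturation_subset]
    using subset_saturation[OF assms(2)] subset_multiples by blast
  have DC: "mult_dens C = mult_dens B"
    unfolding C_def mult_dens_primitive_core[OF saturation_subset] by (rule mult_dens_saturation[OF assms(2)])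
  have "\<exists>E. has_density E 0 \<and>
      ((\<lambda>n. dist_to_set d (shift_pow n x) (hereditary_closure (eta C))) \<longlongrightarrow> 0)
        (inf at_top (principal (- E)))" if x: "x \<in> hereditary_closure (eta B)" for x
  proof -
    define Bad where "Bad k = {n. \<not> (\<exists>m. le_on k (shift_pow n x) (shift_pow m (eta C)))}" for k
    have Bad0: "has_density (Bad k) 0" for k
      unfolding Bad_def by (rule undominated_windows_density_zero[OF assms(2) C1 CB DC x])
    have Bad_mono: "Bad k \<subseteq> Bad l" if "k \<le> l" for k l
      using le_on_mono[OF that] unfolding Bad_def by blast
    obtain E where E: "has_density E 0" "\<And>k. \<forall>\<^sub>F n in at_top. n \<in> Bad k \<longrightarrow> n \<in> E"
      using density_zero_diagonal[of Bad, OF Bad0 Bad_mono] by metis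
    have "((\<lambda>n. dist_to_set d (shift_pow n x) (hereditary_closure (eta C))) \<longlongrightarrow> 0)
        (inf at_top (principal (- E)))"
    proof (rule order_tendstoI)
      fix e :: real assume "0 < e"
      then obtain k where k: "\<And>x y. agree_on k x y \<Longrightarrow> d x y < e" using cylinders_small[OF assms(1)] by blast
      have "dist_to_set d (shift_pow n x) (hereditary_closure (eta C)) < e" if n: "n \<notin> Bad k" for n
      proof -
        obtain m where m: "le_on k (shift_pow n x) (shift_pow m (eta C))" using n by (auto simp: Bad_def)
        \<comment> \<open>Cutting off \<open>shift_pow n x\<close> outside the window gives a nearby point of the hereditary closure.\<close>
        define y where "y i \<longleftrightarrow> \<bar>i\<bar> \<le> int k \<and> shift_pow n x i" for i
        have "y \<in> hereditary_closure (eta C)"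
          by (rule hereditary_closureI[of _ m]) (use m in \<open>auto simp: y_def le_on_def\<close>)
        moreover have "d (shift_pow n x) y < e" by (rule k) (simp add: agree_on_def y_def)
        ultimately show ?thesis using le by (meson le_less_trans)
      qed
      thus "\<forall>\<^sub>F n in inf at_top (principal (- E)). dist_to_set d (shift_pow n x) (hereditary_closure (eta C)) < e"
        using E(2)[of k] unfolding eventually_inf_principal by (auto elim!: eventually_mono)
    next
      fix e :: real assume "e < 0"
      thus "\<forall>\<^sub>F n in inf at_top (principal (- E)). e < dist_to_set d (shift_pow n x) (hereditary_closure (eta C))"
        using nonneg by (intro always_eventually allI) (rule less_le_trans)
    qed
    thus ?thesis using E(1) by blast
  qed
  thus "C \<subseteq> {1..} \<and> taut C \<and> free_of C \<subseteq> free_of B \<and>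
    (\<forall>x \<in> hereditary_closure (eta B). \<exists>E. has_density E 0 \<and>
      ((\<lambda>n. dist_to_set d (shift_pow n x) (hereditary_closure (eta C))) \<longlongrightarrow> 0)
        (inf at_top (principal (- E))))"
    using C1 CB taut_primitive_core_saturation[OF assms(2)] by (auto simp: free_of_subset_iff C_def)
  fix C' assume C': "C' \<subseteq> {1..} \<and> taut C' \<and> free_of C' \<subseteq> free_of B \<and>
    (\<forall>x \<in> hereditary_closure (eta B). \<exists>E. has_density E 0 \<and>
      ((\<lambda>n. dist_to_set d (shift_pow n x) (hereditary_closure (eta C'))) \<longlongrightarrow> 0)
        (inf at_top (principal (- E))))"
  have "eta B \<in> hereditary_closure (eta B)" by (rule hereditary_closureI[of _ 0]) (simp add: shift_pow_def)
  then obtain E where E: "has_density E 0"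
    "((\<lambda>n. dist_to_set d (shift_pow n (eta B)) (hereditary_closure (eta C'))) \<longlongrightarrow> 0)
        (inf at_top (principal (- E)))" using C' by blast
  have "\<forall>\<^sub>F n in at_top. n \<notin> E \<longrightarrow> (\<exists>m. le_on k (shift_pow n (eta B)) (shift_pow m (eta C')))" for k
  proof -
    obtain e where e: "0 < e" "\<And>x y. d x y < e \<Longrightarrow> agree_on k x y" using close_imp_agree_on[OF assms(1)] by blast
    have near: "\<exists>m. le_on k x (shift_pow m (eta C'))"
      if "dist_to_set d x (hereditary_closure (eta C')) < e" for x
    proof -
      have "eta C' \<in> hereditary_closure (eta C')" by (rule hereditary_closureI[of _ 0]) (simp add: shift_pow_def)
      hence "\<exists>y\<in>hereditary_closure (eta C'). d x y < e"
        using that unfolding dist_to_set_def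
        by (subst (asm) cINF_less_iff) (auto intro!: bdd_belowI[of _ 0] simp: metric)
      then obtain y where y: "y \<in> hereditary_closure (eta C')" "d x y < e" by blast
      obtain m where "le_on k y (shift_pow m (eta C'))" by (rule hereditary_closure_le_on[OF y(1)])
      thus ?thesis using agree_on_le_on[OF e(2)[OF y(2)]] by blast
    qed
    have "\<forall>\<^sub>F n in inf at_top (principal (- E)). dist_to_set d (shift_pow n (eta B)) (hereditary_closure (eta C')) < e"
      using E(2) e(1) by (rule order_tendstoD(2))
    thus ?thesis unfolding eventually_inf_principal by eventually_elim (use near in auto)
  qed
  hence "mult_dens C' \<le> mult_dens B"
    using C' by (intro mult_dens_le_of_attraction[OF assms(2) _ E(1)]) auto
  moreover have "mult_dens B \<le> mult_dens C'"
    using C' assms(2) by (intro mult_dens_mono) (auto simp: free_of_subset_iff)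
  ultimately show "C' = C"
    unfolding C_def using C' assms(2) by (intro taut_unique) (auto simp: free_of_subset_iff)
qed

end
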